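(* Let $\mathfrak{e}\subset\mathbb{C}$ be a compact set with positive logarithmic capacity $C(\mathfrak{e})>0$ and with $\Omega=(\mathbb{C}\cup\{\infty\})\setminus\mathfrak{e}$ connected. Suppose $\mathfrak{e}$ is regular for potential theory and has a canonical generator. Suppose that $\mathfrak{e}$ is a PW set and that $n\mapsto\|F_n\|_\infty$ is a bounded almost periodic function on $\mathbb{Z}$, where $F_n=F_{\chi_{\mathfrak{e}}^n}$ is the Widom minimizer for the character $\chi_{\mathfrak{e}}^n$. Then $\mathfrak{e}$ is a DCT set.
   Context: $G_{\mathfrak{e}}$ is the Green's function of $\mathfrak{e}$ with pole at $\infty$: positive and harmonic on $\mathbb{C}\setminus\mathfrak{e}$, upper semicontinuous on $\mathbb{C}$, $G_{\mathfrak{e}}(z)=\log|z|-\log C(\mathfrak{e})+O(1/|z|)$ at $\infty$, and $G_{\mathfrak{e}}=0$ quasi-everywhere on $\mathfrak{e}$. $\mathfrak{e}$ is regular (for potential theory) if $G_{\mathfrak{e}}(x)=0$ for all $x\in\mathfrak{e}$. $\mathfrak{e}$ is a PW (Parreau--Widom) set if $\sum_{z_j}G_{\mathfrak{e}}(z_j)<\infty$, the sum being over the critical points $z_j\in\mathbb{C}\setminus\mathfrak{e}$ of $G_{\mathfrak{e}}$, counted with multiplicity. $\widetilde\Omega$ is the universal cover of $\Omega$, identified with the unit disk $\mathbb{D}$ through the covering map $\mathbf{x}:\mathbb{D}\to\Omega$ with $\mathbf{x}(0)=\infty$ and $\mathbf{x}(z)=Dz^{-1}+O(1)$ near $0$,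 $D>0$. For a function $f$ on $\widetilde\Omega$, $f(\infty)$ denotes its value at the base point $0\in\mathbb{D}$. $\pi_1(\Omega)^*$ is the compact group of characters (homomorphisms from $\pi_1(\Omega)$ to the unit circle) with the topology of pointwise convergence. A function on $\widetilde\Omega$ is $\chi$-automorphic if continuing it around a closed curve $\gamma$ multiplies it by $\chi([\gamma])$. $H^\infty(\Omega,\chi)$ is the set of bounded analytic $\chi$-automorphic functions on $\widetilde\Omega$, with sup norm $\|\cdot\|_\infty$. $B_{\mathfrak{e}}$ is the analytic function on $\widetilde\Omega$ with $|B_{\mathfrak{e}}(z)|=e^{-G_{\mathfrak{e}}(z)}$ and $B_{\mathfrak{e}}(z)=C(\mathfrak{e})z^{-1}+O(z^{-2})$ near $\infty$ (at the base point); it is character automorphic and $\chi_{\mathfrak{e}}$ denotes its character. $\mathfrak{e}$ has a canonical generator if $\{\chi_{\mathfrak{e}}^n\}_{n=-\infty}^{\infty}$ is dense in $\pi_1(\Omega)^*$. For a regular PW set and each $\chi\in\pi_1(\Omega)^*$, the Widom minimizer $F_\chi$ is the (unique, existing) function in $H^\infty(\Omega,\chi)$ with $F_\chi(\infty)=1$ and $\|F_\chi\|_\infty=\inf\{\|h\|_\infty : h\in H^\infty(\Omega,\chi),\ h(\infty)=1\}$. The dual Widom maximizer is $Q_\chi=F_\chi/\|F_\chi\|_\infty$; it is the unique maximizer of $g(\infty)$ over $g\in H^\infty(\Omega,\chi)$ with $\|g\|_\infty=1$, $g(\infty)>0$, and $Q_\chi(\infty)=1/\|F_\chi\|_\infty$.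 DCT (Direct Cauchy Theorem property): a PW set obeys DCT (is a DCT set) if and only if $\chi\mapsto Q_\chi(\infty)$ is continuous on $\pi_1(\Omega)^*$ (theorem of Hayashi and Hasumi, which may be taken as the definition of DCT). A function $f$ on $\mathbb{Z}$ is almost periodic if its translates $\{f(\cdot-m)\}_{m\in\mathbb{Z}}$ form a relatively compact set in the sup norm. *)

theory Defs
  imports
    "HOL-Complex_Analysis.Complex_Analysis"
    "HOL-Probability.Probability_Measure"
    "HOL-Library.Landau_Symbols"
    "HOL-Algebra.Group"
begin

subsection \<open>The Riemann sphere\<close>

datatype riemann_sphere = Fin (affine: complex) | Infty
  where "affine Infty = 0"

text \<open>The topology is that of the one-point compactification of the plane.\<close>

instantiation riemann_sphere :: topological_space
begin

definition open_riemann_sphere :: "riemann_sphere set \<Rightarrow> bool" where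
  "open_riemann_sphere U \<longleftrightarrow> open (Fin -` U) \<and> (Infty \<in> U \<longrightarrow> compact (- (Fin -` U)))"

instance
proof
  show "open (UNIV :: riemann_sphere set)"
    by (simp add: open_riemann_sphere_def)
next
  fix S T :: "riemann_sphere set"
  assume "open S" "open T"
  then show "open (S \<inter> T)"
    by (auto simp: open_riemann_sphere_def open_Int compact_Un)
next
  fix K :: "riemann_sphere set set"
  assume K: "\<forall>S\<in>K. open S"
  have 1: "open (Fin -` (\<Union>K))"
    using K by (auto simp: open_riemann_sphere_def vimage_Union)
  have 2: "compact (- (Fin -` (\<Union>K)))" if inf: "Infty \<in> \<Union>K"
  proof -
    obtain S where S: "S \<in> K" "Infty \<in> S" using inf by auto
    then have "compact (- (Fin -` S))" using K by (auto simp: open_riemann_sphere_def)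
    moreover have "- (Fin -` (\<Union>K)) = - (Fin -` S) \<inter> (- (Fin -` (\<Union>K)))" using S by auto
    ultimately show ?thesis using 1 by (metis compact_Int_closed closed_Compl)
  qed
  show "open (\<Union>K)" using 1 2 by (simp add: open_riemann_sphere_def)
qed

end

definition coord_at_Infty :: "riemann_sphere \<Rightarrow> complex" where
  "coord_at_Infty p = (case p of Fin w \<Rightarrow> 1 / w | Infty \<Rightarrow> 0)"

definition sphere_holomorphic_on :: "(complex \<Rightarrow> riemann_sphere) \<Rightarrow> complex set \<Rightarrow> bool" where
  "sphere_holomorphic_on f S \<longleftrightarrow>
     continuous_on S f \<and>
     (\<lambda>z. affine (f z)) holomorphic_on {z \<in> S. f z \<noteq> Infty} \<and>
     (\<lambda>z. coord_at_Infty (f z)) holomorphic_on {z \<in> S. f z \<noteq> Fin 0}"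

definition Omega :: "complex set \<Rightarrow> riemann_sphere set" where
  "Omega e = - (Fin ` e)"

subsection \<open>Potential theory\<close>

definition log_kernel :: "complex \<Rightarrow> complex \<Rightarrow> ereal" where
  "log_kernel z w = (if z = w then \<infinity> else ereal (- ln (dist z w)))"

text \<open>
  The energy is computed as the integral of the positive part minus that of the negative part;
  the latter is finite for the compactly supported measures considered below.
\<close>

definition log_energy :: "complex measure \<Rightarrow> ereal" where
  "log_energy \<mu> =
     enn2ereal (\<integral>\<^sup>+z. \<integral>\<^sup>+w. e2ennreal (log_kernel z w) \<partial>\<mu> \<partial>\<mu>) -
     enn2ereal (\<integral>\<^sup>+z. \<integral>\<^sup>+w. e2ennreal (- log_kernel z w) \<partial>\<mu> \<partial>\<mu>)"

definition robin_constant :: "complex set \<Rightarrow> ereal" where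
  "robin_constant S = Inf (log_energy ` {\<mu>. prob_space \<mu> \<and> sets \<mu> = sets borel \<and>
     (\<exists>K. compact K \<and> K \<subseteq> S \<and> measure \<mu> K = 1)})"

text \<open>
  Intended for bounded sets, whose Robin constant is never minus infinity.
\<close>

definition log_capacity :: "complex set \<Rightarrow> real" where
  "log_capacity S =
     (if robin_constant S = \<infinity> then 0 else exp (- real_of_ereal (robin_constant S)))"

definition dir_deriv :: "complex \<Rightarrow> (complex \<Rightarrow> real) \<Rightarrow> complex \<Rightarrow> real" where
  "dir_deriv v u z = frechet_derivative u (at z) v"

definition harmonic_on :: "(complex \<Rightarrow> real) \<Rightarrow> complex set \<Rightarrow> bool" where
  "harmonic_on u S \<longleftrightarrow>
     open S \<and> u differentiable_on S \<and>
     (\<forall>v. dir_deriv v u differentiable_on S) \<and>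
     (\<forall>v w. continuous_on S (dir_deriv w (dir_deriv v u))) \<and>
     (\<forall>z\<in>S. dir_deriv 1 (dir_deriv 1 u) z + dir_deriv \<i> (dir_deriv \<i> u) z = 0)"

definition green_function :: "complex set \<Rightarrow> (complex \<Rightarrow> real) \<Rightarrow> bool" where
  "green_function e G \<longleftrightarrow>
     harmonic_on G (- e) \<and> (\<forall>z\<in>- e. G z > 0) \<and>
     (\<forall>z c. G z < c \<longrightarrow> (\<forall>\<^sub>F w in nhds z. G w < c)) \<and>
     (\<lambda>z. G z - (ln (norm z) - ln (log_capacity e))) \<in> O[at_infinity](\<lambda>z. 1 / norm z) \<and>
     log_capacity {z \<in> e. G z \<noteq> 0} = 0"

definition regular_set :: "complex set \<Rightarrow> (complex \<Rightarrow> real) \<Rightarrow> bool" where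
  "regular_set e G \<longleftrightarrow> (\<forall>z\<in>e. G z = 0)"

text \<open>
  The x-derivative minus i times the y-derivative is locally the derivative of an analytic
  function with real part u. The multiplicity of a critical point of a harmonic function is its
  order as a zero of this function.
\<close>

definition complex_gradient :: "(complex \<Rightarrow> real) \<Rightarrow> complex \<Rightarrow> complex" where
  "complex_gradient u z = Complex (dir_deriv 1 u z) (- dir_deriv \<i> u z)"

definition critical_points :: "complex set \<Rightarrow> (complex \<Rightarrow> real) \<Rightarrow> complex set" where
  "critical_points e G = {z \<in> - e. \<forall>v. dir_deriv v G z = 0}"

definition PW_set :: "complex set \<Rightarrow> (complex \<Rightarrow> real) \<Rightarrow> bool" where
  "PW_set e G \<longleftrightarrow>
     (\<lambda>z. of_int (zorder (complex_gradient G) z) * G z) summable_on critical_points e G"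

subsection \<open>The fundamental group and its characters\<close>

definition path_class ::
    "'a::topological_space set \<Rightarrow> (real \<Rightarrow> 'a) \<Rightarrow> (real \<Rightarrow> 'a) set" where
  "path_class S p = {q. homotopic_paths S p q}"

definition fundamental_group ::
    "'a::topological_space set \<Rightarrow> 'a \<Rightarrow> (real \<Rightarrow> 'a) set monoid" where
  "fundamental_group S a =
     \<lparr>carrier = path_class S `
        {p. path p \<and> path_image p \<subseteq> S \<and> pathstart p = a \<and> pathfinish p = a},
      mult = (\<lambda>X Y. \<Union>p\<in>X. \<Union>q\<in>Y. path_class S (p +++ q)),
      one = path_class S (\<lambda>_. a)\<rparr>"

definition circle_group :: "complex monoid" where
  "circle_group = \<lparr>carrier = sphere 0 1, mult = (*), one = 1\<rparr>"

type_synonym sphere_character = "(real \<Rightarrow> riemann_sphere) set \<Rightarrow> complex"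

abbreviation pi1 :: "complex set \<Rightarrow> (real \<Rightarrow> riemann_sphere) set monoid" where
  "pi1 e \<equiv> fundamental_group (Omega e) Infty"

definition characters :: "complex set \<Rightarrow> sphere_character set" where
  "characters e = hom (pi1 e) circle_group \<inter> extensional (carrier (pi1 e))"

definition character_topology :: "complex set \<Rightarrow> sphere_character topology" where
  "character_topology e =
     subtopology (product_topology (\<lambda>_. euclidean) (carrier (pi1 e))) (characters e)"

definition char_power :: "complex set \<Rightarrow> sphere_character \<Rightarrow> int \<Rightarrow> sphere_character" where
  "char_power e \<xi> n = (\<lambda>g\<in>carrier (pi1 e). \<xi> g powi n)"

subsection \<open>The universal cover and character automorphic functions\<close>

text \<open>
  Functions on the universal cover are functions on the unit disk; the base point is 0.
\<close>

definition universal_covering :: "complex set \<Rightarrow> (complex \<Rightarrow> riemann_sphere) \<Rightarrow> bool" where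
  "universal_covering e x \<longleftrightarrow>
     covering_space (ball 0 1) x (Omega e) \<and> sphere_holomorphic_on x (ball 0 1) \<and>
     x 0 = Infty \<and>
     (\<exists>D>0. (\<lambda>z. affine (x z) - of_real D / z) \<in> O[at 0](\<lambda>_. 1))"

text \<open>
  A path c in the disk whose endpoints have the same image under x is the lift of a closed curve,
  and continuation along that curve leads from the value at the start of c to the value at its
  end. The curve need not pass through infinity, so its class is transported to the base point by
  an auxiliary path d; the value of a character does not depend on the choice of d.
\<close>

definition automorphic ::
    "complex set \<Rightarrow> (complex \<Rightarrow> riemann_sphere) \<Rightarrow> sphere_character \<Rightarrow> (complex \<Rightarrow> complex) \<Rightarrow> bool"
  where
  "automorphic e x \<xi> f \<longleftrightarrow>
     (\<forall>c d. path c \<and> path_image c \<subseteq> ball 0 1 \<and> x (pathfinish c) = x (pathstart c) \<and>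
        path d \<and> path_image d \<subseteq> Omega e \<and> pathstart d = Infty \<and> pathfinish d = x (pathstart c) \<longrightarrow>
        f (pathfinish c) =
          \<xi> (path_class (Omega e) (d +++ (x \<circ> c) +++ reversepath d)) * f (pathstart c))"

definition Hinf ::
    "complex set \<Rightarrow> (complex \<Rightarrow> riemann_sphere) \<Rightarrow> sphere_character \<Rightarrow> (complex \<Rightarrow> complex) set" where
  "Hinf e x \<xi> = {f. f holomorphic_on ball 0 1 \<and> bounded (f ` ball 0 1) \<and> automorphic e x \<xi> f}"

definition sup_norm :: "(complex \<Rightarrow> complex) \<Rightarrow> real" where
  "sup_norm f = (SUP z\<in>ball 0 1. norm (f z))"

definition complex_green ::
    "complex set \<Rightarrow> (complex \<Rightarrow> real) \<Rightarrow> (complex \<Rightarrow> riemann_sphere) \<Rightarrow> (complex \<Rightarrow> complex) \<Rightarrow> bool"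
  where
  "complex_green e G x B \<longleftrightarrow>
     B holomorphic_on ball 0 1 \<and>
     (\<forall>z\<in>ball 0 1. norm (B z) = (case x z of Fin w \<Rightarrow> exp (- G w) | Infty \<Rightarrow> 0)) \<and>
     (\<lambda>z. B z - of_real (log_capacity e) / affine (x z)) \<in> O[at 0](\<lambda>z. 1 / affine (x z) ^ 2)"

definition is_character_of ::
    "complex set \<Rightarrow> (complex \<Rightarrow> riemann_sphere) \<Rightarrow> (complex \<Rightarrow> complex) \<Rightarrow> sphere_character \<Rightarrow> bool"
  where
  "is_character_of e x f \<xi> \<longleftrightarrow> \<xi> \<in> characters e \<and> automorphic e x \<xi> f"

text \<open>Here the character argument is the character of the complex Green's function.\<close>

definition canonical_generator :: "complex set \<Rightarrow> sphere_character \<Rightarrow> bool" where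
  "canonical_generator e \<xi> \<longleftrightarrow>
     character_topology e closure_of range (char_power e \<xi>) = topspace (character_topology e)"

subsection \<open>Widom minimizers and the Direct Cauchy Theorem property\<close>

definition is_widom_minimizer ::
    "complex set \<Rightarrow> (complex \<Rightarrow> riemann_sphere) \<Rightarrow> sphere_character \<Rightarrow> (complex \<Rightarrow> complex) \<Rightarrow> bool"
  where
  "is_widom_minimizer e x \<xi> f \<longleftrightarrow>
     f \<in> Hinf e x \<xi> \<and> f 0 = 1 \<and>
     sup_norm f = Inf (sup_norm ` {h \<in> Hinf e x \<xi>. h 0 = 1})"

text \<open>
  For regular Parreau--Widom sets the minimizer is unique on the disk; its values outside the disk are irrelevant,
  hence an indefinite choice.
\<close>

definition widom_minimizer ::
    "complex set \<Rightarrow> (complex \<Rightarrow> riemann_sphere) \<Rightarrow> sphere_character \<Rightarrow> complex \<Rightarrow> complex" where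
  "widom_minimizer e x \<xi> = (SOME f. is_widom_minimizer e x \<xi> f)"

definition widom_maximizer ::
    "complex set \<Rightarrow> (complex \<Rightarrow> riemann_sphere) \<Rightarrow> sphere_character \<Rightarrow> complex \<Rightarrow> complex" where
  "widom_maximizer e x \<xi> =
     (\<lambda>z. widom_minimizer e x \<xi> z / of_real (sup_norm (widom_minimizer e x \<xi>)))"

definition DCT_set ::
    "complex set \<Rightarrow> (complex \<Rightarrow> real) \<Rightarrow> (complex \<Rightarrow> riemann_sphere) \<Rightarrow> bool" where
  "DCT_set e G x \<longleftrightarrow>
     PW_set e G \<and>
     continuous_map (character_topology e) euclidean (\<lambda>\<xi>. widom_maximizer e x \<xi> 0)"

subsection \<open>Almost periodicity\<close>

text \<open>
  The bounded functions on the integers with the sup norm form the type of bounded continuous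
  functions, as the topology of the integers is discrete.
\<close>

definition almost_periodic :: "(int \<Rightarrow> real) \<Rightarrow> bool" where
  "almost_periodic f \<longleftrightarrow>
     (\<exists>K. compact K \<and> (\<forall>m. (\<lambda>k. f (k - m)) \<in> apply_bcontfun ` K))"

end

theory Submission
  imports Defs
begin

text \<open>
  Write \<open>N(\<chi>)\<close> for the norm of the Widom minimizer of the character \<open>\<chi>\<close>, so that the dual
  maximizer takes the value \<open>1 / N(\<chi>)\<close> at the base point. A product of competitors is a competitor
  for the product of the characters, so \<open>N\<close> is submultiplicative, and \<open>N \<ge> 1\<close>. Hence \<open>N\<close> is
  continuous everywhere as soon as \<open>N(\<chi>) \<rightarrow> 1\<close> when \<open>\<chi>\<close> tends to the trivial character
  (\<open>widom_norm_ratio\<close>, \<open>continuous_map_inverse_widom_norm\<close>).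

  A normal family argument shows that \<open>N\<close> is lower semicontinuous (\<open>competitor_bound_closure\<close>).
  As the powers of the generator \<open>\<xi>\<close> are dense, it is therefore enough to bound \<open>f(n) = N(\<xi>\<^sup>n)\<close> by
  \<open>1 + \<epsilon>\<close> for all \<open>n\<close> with \<open>\<xi>\<^sup>n\<close> close to the trivial character. Here almost periodicity enters
  (\<open>almost_periodic_lsc_imp_usc\<close>): semicontinuity and total boundedness of the translates give
  \<open>f(m + n) > f(m) - \<eta>\<close> for all \<open>m\<close> at once, and the pigeonhole principle gives a multiple
  \<open>p n\<close>, with \<open>p\<close> bounded independently of \<open>n\<close>, at which \<open>f\<close> is back near \<open>f(0) = 1\<close>. Since
  \<open>f\<close> loses at most \<open>\<eta>\<close> per step, \<open>f(n)\<close> cannot be much larger than 1.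

  It remains to see that every character has a competitor, so that the minimizers exist. For
  \<open>\<xi>\<^sup>n\<close> with \<open>n \<ge> 0\<close> the \<open>n\<close>-th power of the product of the complex Green's function with the
  covering map is a multiple of one (\<open>competitor_bound_nonneg_power\<close>). The nonnegative powers are
  dense because rotations of a torus are recurrent, and the norms \<open>f(n)\<close> are bounded, so
  semicontinuity provides a competitor with the same bound for every character
  (\<open>competitor_bound_all\<close>).
\<close>

section \<open>Almost periodic functions on the integers\<close>

lemma almost_periodic_finite_net:
  assumes "almost_periodic f" and "0 < \<epsilon>"
  obtains A where "finite A"
    and "\<And>m. \<exists>a\<in>A. \<forall>k. \<bar>f (k + m) - f (k + a)\<bar> < \<epsilon>"
proof -
  obtain K where K: "compact K" "\<And>m. (\<lambda>k. f (k - m)) \<in> apply_bcontfun ` K"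
    using assms by (auto simp: almost_periodic_def)
  obtain C where C: "finite C" "K \<subseteq> (\<Union>c\<in>C. ball c (\<epsilon>/2))"
    using K(1) \<open>0 < \<epsilon>\<close> unfolding compact_eq_totally_bounded by (meson half_gt_zero)
  define near where "near c a \<longleftrightarrow> (\<exists>g\<in>ball c (\<epsilon>/2). \<forall>k. apply_bcontfun g k = f (k + a))" for c a
  define A where "A = (\<lambda>c. SOME a. near c a) ` C"
  have "\<exists>a\<in>A. \<forall>k. \<bar>f (k + m) - f (k + a)\<bar> < \<epsilon>" for m
  proof -
    have "(\<lambda>k. f (k + m)) \<in> apply_bcontfun ` K"
      using K(2)[of "- m"] by simp
    then obtain g where g: "g \<in> K" "\<And>k. apply_bcontfun g k = f (k + m)" by (metis image_iff)
    then obtain c where c: "c \<in> C" "g \<in> ball c (\<epsilon>/2)" using C by blast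
    then have "near c m" using g unfolding near_def by blast
    then have "near c (SOME a. near c a)" by (rule someI)
    then obtain g' where g': "g' \<in> ball c (\<epsilon>/2)"
      "\<And>k. apply_bcontfun g' k = f (k + (SOME a. near c a))" by (auto simp: near_def)
    have "\<bar>f (k + m) - f (k + (SOME a. near c a))\<bar> < \<epsilon>" for k
    proof -
      have "dist (apply_bcontfun g k) (apply_bcontfun g' k) \<le> dist g g'" by (rule dist_bounded)
      also have "\<dots> < \<epsilon>" using c g' by (metis dist_triangle_half_r mem_ball)
      finally show ?thesis by (simp add: g g' dist_real_def)
    qed
    then show ?thesis using c by (auto simp: A_def)
  qed
  moreover have "finite A" using C by (simp add: A_def)
  ultimately show thesis using that by blast
qed

text \<open>
  Almost periodicity upgrades lower semicontinuity along a filter to continuity at 0. The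
  translates of \<open>f\<close> form a totally bounded family, so for \<open>n\<close> far along the filter the function
  cannot drop by more than a small \<open>\<eta>\<close> in any step \<open>m \<mapsto> m + n\<close>, uniformly in \<open>m\<close>. On the
  other hand, among the translates by \<open>0, n, 2 n, \<dots>, N n\<close> two nearly coincide, where \<open>N\<close> is a
  covering number that does not depend on \<open>n\<close>; hence \<open>f\<close> nearly returns to \<open>f 0\<close> at some
  multiple of \<open>n\<close> between \<open>n\<close> and \<open>N n\<close>. A large value at \<open>n\<close> could not have come down again
  in fewer than \<open>N\<close> steps of size \<open>\<eta>\<close>.
\<close>
lemma almost_periodic_lsc_imp_usc:
  fixes f :: "int \<Rightarrow> real" and F :: "int filter"
  assumes ap: "almost_periodic f"
    and lsc: "\<And>m \<eta>. 0 < \<eta> \<Longrightarrow> \<forall>\<^sub>F n in F. f m - \<eta> < f (m + n)"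
    and \<epsilon>: "0 < \<epsilon>"
  shows "\<forall>\<^sub>F n in F. f n < f 0 + \<epsilon>"
proof -
  obtain A where A: "finite A" "\<And>m. \<exists>a\<in>A. \<forall>k. \<bar>f (k + m) - f (k + a)\<bar> < \<epsilon>/4"
    using almost_periodic_finite_net[OF ap, of "\<epsilon>/4"] \<epsilon> by auto
  define N where "N = card A"
  define \<eta> where "\<eta> = \<epsilon> / (2 * (real N + 1))"
  have \<eta>: "\<eta> > 0" using \<epsilon> by (simp add: \<eta>_def)
  obtain A' where A': "finite A'" "\<And>m. \<exists>a\<in>A'. \<forall>k. \<bar>f (k + m) - f (k + a)\<bar> < \<eta>/3"
    using almost_periodic_finite_net[OF ap, of "\<eta>/3"] \<eta> by auto
  have "\<forall>\<^sub>F n in F. \<forall>a\<in>A'. f a - \<eta>/3 < f (a + n)"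
    using A'(1) lsc[of "\<eta>/3"] \<eta> by (simp add: eventually_ball_finite)
  then show ?thesis
  proof eventually_elim
    case (elim n)
    \<comment> \<open>The finitely many translates indexed by \<open>A'\<close> make the semicontinuity uniform in \<open>m\<close>.\<close>
    have step: "f m - \<eta> < f (m + n)" for m
    proof -
      obtain a where a: "a \<in> A'" "\<And>k. \<bar>f (k + m) - f (k + a)\<bar> < \<eta>/3" using A'(2) by blast
      have "f a - \<eta>/3 < f (a + n)" using elim a by blast
      then show ?thesis using a(2)[of 0] a(2)[of n] by (simp add: add.commute abs_if split: if_splits)
    qed
    have steps: "f m - real j * \<eta> \<le> f (m + int j * n)" for m j
    proof (induction j)
      case (Suc j)
      then show ?case using step[of "m + int j * n"] by (simp add: algebra_simps)
    qed simp
    have "\<forall>j. \<exists>a. a \<in> A \<and> (\<forall>k. \<bar>f (k + int j * n) - f (k + a)\<bar> < \<epsilon>/4)"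
      using A(2) by blast
    then obtain a where a: "\<And>j. a j \<in> A" "\<And>j k. \<bar>f (k + int j * n) - f (k + a j)\<bar> < \<epsilon>/4"
      by (auto dest!: choice)
    have "\<not> inj_on a {..N}"
    proof
      assume "inj_on a {..N}"
      then have "card {..N} \<le> card A" using a A by (intro card_inj_on_le) auto
      then show False by (simp add: N_def)
    qed
    then obtain i j where ij: "i < j" "j \<le> N" "a i = a j"
      by (metis (no_types, lifting) atMost_iff inj_onI linorder_neqE_nat)
    \<comment> \<open>One less than the recurrence index, as the descent starts at \<open>n\<close> and not at 0.\<close>
    define p where "p = j - i - 1"
    have eq: "- int i * n + int j * n = n + int p * n" using ij by (simp add: p_def of_nat_diff algebra_simps)
    have "\<bar>f 0 - f (n + int p * n)\<bar> < \<epsilon>/2"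
      using a(2)[of "- int i * n" i] a(2)[of "- int i * n" j] unfolding eq by (simp add: ij(3) abs_if split: if_splits)
    moreover have "f n - real p * \<eta> \<le> f (n + int p * n)" by (rule steps)
    moreover have "real p * \<eta> < \<epsilon>/2"
    proof -
      have "real p * \<eta> < (real N + 1) * \<eta>" using \<eta> ij by (intro mult_strict_right_mono) (auto simp: p_def)
      also have "\<dots> = \<epsilon>/2" by (simp add: \<eta>_def field_simps)
      finally show ?thesis .
    qed
    ultimately show ?case by (simp add: abs_if split: if_splits)
  qed
qed

text \<open>
  Recurrence of a rotation of a finite-dimensional torus, by compactness: a convergent subsequence
  of the powers has consecutive members whose quotient is close to 1.
\<close>
lemma simultaneous_recurrence:
  fixes u :: "'a \<Rightarrow> complex"
  assumes "finite S" and "\<And>s. s \<in> S \<Longrightarrow> norm (u s) = 1" and "0 < \<epsilon>"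
  obtains p where "N \<le> p" and "\<And>s. s \<in> S \<Longrightarrow> norm (u s ^ p - 1) < \<epsilon>"
proof -
  have "\<exists>r::nat\<Rightarrow>nat. strict_mono r \<and> (\<forall>s\<in>S. convergent (\<lambda>k. u s ^ r k))"
    using assms(1,2)
  proof (induction S)
    case empty
    show ?case by (auto intro!: exI[of _ id] strict_mono_id)
  next
    case (insert t S)
    then obtain r :: "nat \<Rightarrow> nat" where r: "strict_mono r" "\<And>s. s \<in> S \<Longrightarrow> convergent (\<lambda>k. u s ^ r k)"
      by auto
    have "bounded (range (\<lambda>k. u t ^ r k))"
      using insert.prems[of t] by (intro boundedI[of _ 1]) (auto simp: norm_power)
    then obtain l q where q: "strict_mono q" "((\<lambda>k. u t ^ r k) \<circ> q) \<longlonglongrightarrow> l"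
      using bounded_imp_convergent_subsequence by blast
    have "convergent (\<lambda>k. u s ^ r (q k))" if "s \<in> insert t S" for s
    proof (cases "s = t")
      case True
      then show ?thesis using q by (auto simp: convergent_def o_def)
    next
      case False
      then show ?thesis
        using convergent_subseq_convergent[OF r(2) q(1), of s] that by (simp add: o_def)
    qed
    moreover have "strict_mono (r \<circ> q)" using r q by (simp add: strict_mono_o)
    ultimately show ?case by (intro exI[of _ "r \<circ> q"]) (simp add: o_def)
  qed
  then obtain r :: "nat \<Rightarrow> nat" where r: "strict_mono r" "\<And>s. s \<in> S \<Longrightarrow> Cauchy (\<lambda>k. u s ^ r k)"
    by (auto simp: Cauchy_convergent_iff)
  have "\<forall>s\<in>S. \<exists>k. \<forall>m\<ge>k. \<forall>n\<ge>k. norm (u s ^ r m - u s ^ r n) < \<epsilon>"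
    using r(2) \<open>0 < \<epsilon>\<close> by (auto simp: Cauchy_iff)
  then obtain k where k: "\<And>s m n. s \<in> S \<Longrightarrow> m \<ge> k s \<Longrightarrow> n \<ge> k s \<Longrightarrow> norm (u s ^ r m - u s ^ r n) < \<epsilon>"
    by metis
  define M where "M = (\<Sum>s\<in>S. k s)"
  have M: "k s \<le> M" if "s \<in> S" for s using that assms(1) by (simp add: M_def member_le_sum)
  have mono: "r M + n \<le> r (M + n)" for n
  proof (induction n)
    case (Suc n)
    then show ?case using strict_monoD[OF r(1), of "M + n" "M + Suc n"] by simp
  qed simp
  define p where "p = r (M + N) - r M"
  have rp: "r (M + N) = r M + p" using mono[of N] by (simp add: p_def)
  have "norm (u s ^ p - 1) < \<epsilon>" if s: "s \<in> S" for s
  proof -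
    have "norm (u s ^ r (M + N) - u s ^ r M) < \<epsilon>" using k M s by (meson trans_le_add1)
    also have "u s ^ r (M + N) - u s ^ r M = u s ^ r M * (u s ^ p - 1)"
      by (simp add: rp power_add algebra_simps)
    finally show ?thesis using assms(2)[OF s] by (simp add: norm_mult norm_power)
  qed
  moreover have "N \<le> p" using mono[of N] by (simp add: p_def)
  ultimately show thesis using that by blast
qed

section \<open>Characters of the fundamental group\<close>

lemma path_class_cong:
  assumes "homotopic_paths S p q"
  shows "path_class S p = path_class S q"
proof -
  have "homotopic_paths S p r \<longleftrightarrow> homotopic_paths S q r" for r
    using assms homotopic_paths_trans homotopic_paths_sym by metis
  then show ?thesis by (simp add: path_class_def)
qed

lemma path_class_in_carrier:
  assumes "path p" "path_image p \<subseteq> S" "pathstart p = a" "pathfinish p = a"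
  shows "path_class S p \<in> carrier (fundamental_group S a)"
  using assms by (auto simp: fundamental_group_def)

lemma fundamental_group_mult_closed:
  assumes "g \<in> carrier (fundamental_group S a)" "h \<in> carrier (fundamental_group S a)"
  shows "g \<otimes>\<^bsub>fundamental_group S a\<^esub> h \<in> carrier (fundamental_group S a)"
proof -
  obtain p where p: "path p" "path_image p \<subseteq> S" "pathstart p = a" "pathfinish p = a" "g = path_class S p"
    using assms(1) by (auto simp: fundamental_group_def)
  obtain q where q: "path q" "path_image q \<subseteq> S" "pathstart q = a" "pathfinish q = a" "h = path_class S q"
    using assms(2) by (auto simp: fundamental_group_def)
  have "path_class S (p' +++ q') = path_class S (p +++ q)" if "p' \<in> g" "q' \<in> h" for p' q'
  proof (rule path_class_cong)
    have "homotopic_paths S p p'" "homotopic_paths S q q'"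
      using that by (auto simp: p q path_class_def)
    then show "homotopic_paths S (p' +++ q') (p +++ q)"
      using p q by (intro homotopic_paths_sym[OF homotopic_paths_join]) auto
  qed
  moreover have "p \<in> g" "q \<in> h" using p q by (auto simp: path_class_def)
  ultimately have "(\<Union>p'\<in>g. \<Union>q'\<in>h. path_class S (p' +++ q')) = path_class S (p +++ q)"
    by blast
  then have "g \<otimes>\<^bsub>fundamental_group S a\<^esub> h = path_class S (p +++ q)"
    by (simp add: fundamental_group_def)
  also have "\<dots> \<in> carrier (fundamental_group S a)"
    using p q by (intro path_class_in_carrier) (auto simp: path_image_join)
  finally show ?thesis .
qed

lemma characters_iff:
  "\<xi> \<in> characters e \<longleftrightarrow> \<xi> \<in> extensional (carrier (pi1 e)) \<and> (\<forall>g\<in>carrier (pi1 e). norm (\<xi> g) = 1) \<and>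
     (\<forall>g\<in>carrier (pi1 e). \<forall>h\<in>carrier (pi1 e). \<xi> (g \<otimes>\<^bsub>pi1 e\<^esub> h) = \<xi> g * \<xi> h)"
  by (auto simp: characters_def hom_def circle_group_def)

lemma norm_character: "\<xi> \<in> characters e \<Longrightarrow> g \<in> carrier (pi1 e) \<Longrightarrow> norm (\<xi> g) = 1"
  by (simp add: characters_iff)

definition char_quotient :: "complex set \<Rightarrow> sphere_character \<Rightarrow> sphere_character \<Rightarrow> sphere_character" where
  "char_quotient e \<xi> \<eta> = (\<lambda>g\<in>carrier (pi1 e). \<xi> g / \<eta> g)"

lemma char_quotient_in_characters:
  assumes "\<xi> \<in> characters e" "\<eta> \<in> characters e"
  shows "char_quotient e \<xi> \<eta> \<in> characters e"
  using assms by (auto simp: characters_iff char_quotient_def norm_divide fundamental_group_mult_closed)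

lemma char_power_in_characters:
  assumes "\<xi> \<in> characters e"
  shows "char_power e \<xi> n \<in> characters e"
  using assms
  by (auto simp: characters_iff char_power_def norm_power_int fundamental_group_mult_closed power_int_mult_distrib)

lemma topspace_character_topology: "topspace (character_topology e) = characters e"
  by (auto simp: character_topology_def characters_def extensional_def PiE_def)

lemma continuous_map_character_eval:
  assumes "g \<in> carrier (pi1 e)"
  shows "continuous_map (character_topology e) euclidean (\<lambda>\<xi>. \<xi> g)"
  unfolding character_topology_def
  using assms by (intro continuous_map_from_subtopology continuous_map_product_projection)

lemma openin_character_nbhd:
  assumes "finite S" "S \<subseteq> carrier (pi1 e)"
  shows "openin (character_topology e) {\<eta> \<in> characters e. \<forall>g\<in>S. norm (\<eta> g - \<xi> g) < \<epsilon>}"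
  using assms
proof (induction S)
  case empty
  then show ?case by (simp flip: topspace_character_topology)
next
  case (insert g S)
  have "openin (character_topology e) {\<eta> \<in> topspace (character_topology e). \<eta> g \<in> ball (\<xi> g) \<epsilon>}"
    using insert.prems by (intro openin_continuous_map_preimage[OF continuous_map_character_eval]) auto
  then have "openin (character_topology e) ({\<eta> \<in> characters e. \<forall>g\<in>S. norm (\<eta> g - \<xi> g) < \<epsilon>} \<inter>
     {\<eta> \<in> topspace (character_topology e). \<eta> g \<in> ball (\<xi> g) \<epsilon>})"
    using insert by (intro openin_Int) auto
  also have "\<dots> = {\<eta> \<in> characters e. \<forall>g\<in>insert g S. norm (\<eta> g - \<xi> g) < \<epsilon>}"
    by (auto simp: topspace_character_topology dist_norm norm_minus_commute)
  finally show ?case .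
qed

lemma continuous_map_into_character_topology:
  assumes "\<And>t. t \<in> topspace X \<Longrightarrow> f t \<in> characters e"
    and "\<And>g. g \<in> carrier (pi1 e) \<Longrightarrow> continuous_map X euclidean (\<lambda>t. f t g)"
  shows "continuous_map X (character_topology e) f"
  unfolding character_topology_def continuous_map_in_subtopology continuous_map_componentwise
  using assms by (auto simp: characters_def)

section \<open>Automorphy along lifted loops\<close>

definition admissible_paths ::
    "complex set \<Rightarrow> (complex \<Rightarrow> riemann_sphere) \<Rightarrow> (real \<Rightarrow> complex) \<Rightarrow> (real \<Rightarrow> riemann_sphere) \<Rightarrow> bool" where
  "admissible_paths e x c d \<longleftrightarrow>
     path c \<and> path_image c \<subseteq> ball 0 1 \<and> x (pathfinish c) = x (pathstart c) \<and>
     path d \<and> path_image d \<subseteq> Omega e \<and> pathstart d = Infty \<and> pathfinish d = x (pathstart c)"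

definition monodromy_class ::
    "complex set \<Rightarrow> (complex \<Rightarrow> riemann_sphere) \<Rightarrow> (real \<Rightarrow> complex) \<Rightarrow> (real \<Rightarrow> riemann_sphere) \<Rightarrow>
     (real \<Rightarrow> riemann_sphere) set" where
  "monodromy_class e x c d = path_class (Omega e) (d +++ (x \<circ> c) +++ reversepath d)"

lemma automorphic_iff:
  "automorphic e x \<xi> f \<longleftrightarrow> (\<forall>c d. admissible_paths e x c d \<longrightarrow>
     f (pathfinish c) = \<xi> (monodromy_class e x c d) * f (pathstart c))"
  by (simp add: automorphic_def admissible_paths_def monodromy_class_def)

lemma admissible_pathsD:
  assumes "admissible_paths e x c d"
  shows "pathstart c \<in> ball 0 1" "pathfinish c \<in> ball 0 1"
  using assms pathstart_in_path_image[of c] pathfinish_in_path_image[of c]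
  unfolding admissible_paths_def by blast+

section \<open>Normal families in the topology of pointwise convergence\<close>

text \<open>
  Montel's theorem, recast so that it can be combined with the finite intersection property: the
  characters are approximated by a net of powers, not by a sequence. The functions are normalised
  to vanish off \<open>S\<close> so that they lie in a product of compact discs, and only closedness is at
  stake. A pointwise limit point \<open>f\<close> is, on a countable dense set together with any one further
  point, the limit of a sequence of the family, hence agrees there with a holomorphic function;
  density makes these holomorphic functions the same for all choices of the further point.
\<close>
lemma compact_bounded_holomorphic:
  fixes S :: "complex set"
  assumes "open S"
  shows "compact {f. f holomorphic_on S \<and> (\<forall>z\<in>S. norm (f z) \<le> M) \<and> (\<forall>z. z \<notin> S \<longrightarrow> f z = 0)}"
    (is "compact ?H")
proof (cases "S = {}")
  case True
  then have "?H = {\<lambda>_. 0}" by auto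
  then show ?thesis by (metis finite.emptyI finite.insertI finite_imp_compact)
next
  case False
  define P where "P = (\<Pi>\<^sub>E z\<in>UNIV. if z \<in> S then cball (0::complex) M else {0::complex})"
  have P: "compact P"
  proof -
    have "compactin (product_topology (\<lambda>_. euclidean) UNIV) P"
      unfolding P_def compactin_PiE by auto
    then show ?thesis by (simp add: euclidean_product_topology)
  qed
  have HP: "?H \<subseteq> P" by (auto simp: P_def)
  have "closed P"
  proof -
    have "closedin (product_topology (\<lambda>_. euclidean) UNIV) P"
      unfolding P_def closedin_product_topology by auto
    then show ?thesis by (simp add: euclidean_product_topology)
  qed
  have "closure ?H \<subseteq> ?H"
  proof
    fix f assume f: "f \<in> closure ?H"
    have fP: "f \<in> P" using f HP \<open>closed P\<close> closure_minimal by blast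
    have approx: "\<exists>h\<in>?H. \<forall>z\<in>Z. norm (h z - f z) < \<delta>" if "finite Z" "\<delta> > 0" for Z \<delta>
    proof -
      have "open (\<Inter>z\<in>Z. {h. h z \<in> ball (f z) \<delta>})"
        using that open_vimage[OF open_ball continuous_on_product_coordinates]
        by (intro open_INT) (auto simp: vimage_def)
      moreover have "f \<in> (\<Inter>z\<in>Z. {h. h z \<in> ball (f z) \<delta>}) \<inter> closure ?H"
        using f that by simp
      ultimately have "(\<Inter>z\<in>Z. {h. h z \<in> ball (f z) \<delta>}) \<inter> ?H \<noteq> {}"
        using open_Int_closure_eq_empty by blast
      then show ?thesis by (auto simp: dist_norm norm_minus_commute)
    qed
    obtain D where D: "countable D" "D \<subseteq> S" "S \<subseteq> closure D"
      using separable[of S] by blast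
    have "D \<noteq> {}" using D False by auto
    define d where "d = from_nat_into D"
    have d: "range d = D" using D \<open>D \<noteq> {}\<close> by (simp add: d_def)
    have lim: "\<exists>g. g holomorphic_on S \<and> (\<forall>z\<in>insert w D. g z = f z)" if w: "w \<in> S" for w
    proof -
      \<comment> \<open>\<open>w\<close> is kept at every stage, while the dense set is exhausted.\<close>
      define near where "near k h \<longleftrightarrow> h \<in> ?H \<and>
          (\<forall>z\<in>insert w (d ` {..k}). norm (h z - f z) < inverse (real (Suc k)))" for k h
      have "\<exists>h. near k h" for k
        using approx[of "insert w (d ` {..k})" "inverse (real (Suc k))"] unfolding near_def Bex_def by simp
      then obtain h where near: "\<And>k. near k (h k)" by metis
      have h: "h k \<in> ?H" "z \<in> insert w (d ` {..k}) \<Longrightarrow> norm (h k z - f z) < inverse (real (Suc k))" for k z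
        using near[of k] unfolding near_def by (rule conjunct1, rule bspec[OF conjunct2])
      have conv: "(\<lambda>k. h k z) \<longlonglongrightarrow> f z" if zD: "z \<in> insert w D" for z
      proof -
        obtain j where j: "z = w \<or> z = d j"
          using zD unfolding d[symmetric] by blast
        have "(\<lambda>k. h k z - f z) \<longlonglongrightarrow> 0"
        proof (rule Lim_null_comparison[OF _ LIMSEQ_inverse_real_of_nat])
          show "\<forall>\<^sub>F k in sequentially. norm (h k z - f z) \<le> inverse (real (Suc k))"
            using eventually_ge_at_top[of j]
          proof eventually_elim
            case (elim k)
            have "z \<in> insert w (d ` {..k})" using j elim by auto
            then show ?case by (rule less_imp_le[OF h(2)])
          qed
        qed
        then show ?thesis by (simp add: LIM_zero_iff)
      qed
      obtain g r where g: "g holomorphic_on S" "strict_mono (r :: nat \<Rightarrow> nat)"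
        "\<And>z. z \<in> S \<Longrightarrow> (\<lambda>k. h (r k) z) \<longlonglongrightarrow> g z"
        
      proof (rule Montel[OF \<open>open S\<close>, of ?H h])
        show "\<exists>B. \<forall>h\<in>?H. \<forall>z\<in>K. norm (h z) \<le> B" if "compact K" "K \<subseteq> S" for K
          using that by (intro exI[of _ M]) auto
        show "range h \<subseteq> ?H" using h(1) by blast
      qed auto
      have "g z = f z" if z: "z \<in> insert w D" for z
      proof (rule LIMSEQ_unique)
        show "(\<lambda>k. h (r k) z) \<longlonglongrightarrow> g z" using g z w D by auto
        show "(\<lambda>k. h (r k) z) \<longlonglongrightarrow> f z"
          using LIMSEQ_subseq_LIMSEQ[OF conv[OF z] g(2)] by (simp add: o_def)
      qed
      then show ?thesis using g by blast
    qed
    obtain w where w: "w \<in> S" using False by auto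
    obtain g where g: "g holomorphic_on S" "\<And>z. z \<in> D \<Longrightarrow> g z = f z" using lim[OF w] by blast
    have "g z = f z" if z: "z \<in> S" for z
    proof -
      obtain k where k: "k holomorphic_on S" "\<And>z. z \<in> D \<Longrightarrow> k z = f z" "k z = f z" using lim[OF z] by blast
      obtain t where t: "\<And>n. t n \<in> D" "t \<longlonglongrightarrow> z" using z D by (metis closure_sequential subsetD)
      have "t n \<in> S" for n using t(1) D(2) by blast
      then have lims: "(\<lambda>n. g (t n)) \<longlonglongrightarrow> g z" "(\<lambda>n. k (t n)) \<longlonglongrightarrow> k z"
        using g(1) k(1) t(2) z
        by (auto intro: continuous_on_tendsto_compose[OF holomorphic_on_imp_continuous_on])
      have "g z = k z" using lims unfolding g(2)[OF t(1)] k(2)[OF t(1)] by (rule LIMSEQ_unique)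
      then show ?thesis using k by simp
    qed
    then have "f holomorphic_on S" using g(1) holomorphic_transform by blast
    then show "f \<in> ?H" using fP by (auto simp: P_def PiE_iff split: if_splits)
  qed
  then have "closed ?H" by (simp add: closure_subset_eq)
  then show ?thesis using P HP compact_Int_closed[of P ?H] by (simp add: inf.absorb2)
qed

section \<open>Widom minimizers\<close>

lemma norm_le_sup_norm:
  assumes "bounded (f ` ball 0 1)" "z \<in> ball 0 1"
  shows "norm (f z) \<le> sup_norm f"
proof -
  have "bdd_above ((\<lambda>z. norm (f z)) ` ball 0 1)"
    using assms(1) by (auto simp: bounded_iff bdd_above_def)
  then show ?thesis unfolding sup_norm_def using assms(2) by (rule cSUP_upper2) auto
qed

lemma sup_norm_le:
  assumes "\<And>z. z \<in> ball 0 1 \<Longrightarrow> norm (f z) \<le> M"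
  shows "sup_norm f \<le> M"
  unfolding sup_norm_def using assms by (intro cSUP_least) auto

text \<open>
  The inequality \<open>\<parallel>F\<^sub>\<xi>\<parallel> \<le> M\<close> phrased as the existence of an admissible function, which makes sense
  before a minimizer is known to exist and passes to limits of characters.
\<close>
definition competitor_bound ::
    "complex set \<Rightarrow> (complex \<Rightarrow> riemann_sphere) \<Rightarrow> sphere_character \<Rightarrow> real \<Rightarrow> bool" where
  "competitor_bound e x \<xi> M \<longleftrightarrow> (\<exists>f\<in>Hinf e x \<xi>. f 0 = 1 \<and> (\<forall>z\<in>ball 0 1. norm (f z) \<le> M))"

definition widom_norm :: "complex set \<Rightarrow> (complex \<Rightarrow> riemann_sphere) \<Rightarrow> sphere_character \<Rightarrow> real" where
  "widom_norm e x \<xi> = sup_norm (widom_minimizer e x \<xi>)"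

lemma competitor_bound_ge_1:
  assumes "competitor_bound e x \<xi> M"
  shows "1 \<le> M"
proof -
  obtain f :: "complex \<Rightarrow> complex" where "f 0 = 1" "\<forall>z\<in>ball 0 1. norm (f z) \<le> M"
    using assms unfolding competitor_bound_def by blast
  then show ?thesis by (metis centre_in_ball norm_one zero_less_one)
qed

lemma competitor_bound_mono:
  "competitor_bound e x \<xi> M \<Longrightarrow> M \<le> N \<Longrightarrow> competitor_bound e x \<xi> N"
  unfolding competitor_bound_def by (meson order_trans)

locale uniformized_domain =
  fixes e :: "complex set" and x :: "complex \<Rightarrow> riemann_sphere"
  assumes universal_covering: "universal_covering e x"
begin

lemma continuous_x: "continuous_on (ball 0 1) x"
  and image_x: "x ` ball 0 1 = Omega e"
  and x_0: "x 0 = Infty"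
  using universal_covering by (auto simp: universal_covering_def covering_space_def)

lemma monodromy_class_in_pi1:
  assumes "admissible_paths e x c d"
  shows "monodromy_class e x c d \<in> carrier (pi1 e)"
proof -
  have c: "path (x \<circ> c)" "path_image (x \<circ> c) \<subseteq> Omega e"
    using assms continuous_x image_x
    by (auto simp: admissible_paths_def path_image_compose
        intro!: path_continuous_image continuous_on_subset[OF continuous_x])
  show ?thesis
    unfolding monodromy_class_def using assms c
    by (intro path_class_in_carrier)
      (auto simp: admissible_paths_def path_image_join pathstart_compose pathfinish_compose)
qed

lemma Hinf_mult:
  assumes "f \<in> Hinf e x \<xi>" "h \<in> Hinf e x \<eta>"
    and "\<And>g. g \<in> carrier (pi1 e) \<Longrightarrow> \<zeta> g = \<xi> g * \<eta> g"
  shows "(\<lambda>z. f z * h z) \<in> Hinf e x \<zeta>"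
proof -
  have "bounded ((\<lambda>z. f z * h z) ` ball 0 1)"
  proof -
    have "bounded (f ` ball 0 1)" "bounded (h ` ball 0 1)"
      using assms(1,2) by (auto simp: Hinf_def)
    then have "norm (f z * h z) \<le> sup_norm f * sup_norm h" if "z \<in> ball 0 1" for z
      unfolding norm_mult using that
      by (intro mult_mono norm_le_sup_norm order_trans[OF norm_ge_zero norm_le_sup_norm]) auto
    then show ?thesis by (intro boundedI[of _ "sup_norm f * sup_norm h"]) auto
  qed
  moreover have "automorphic e x \<zeta> (\<lambda>z. f z * h z)"
    using assms by (auto simp: automorphic_iff Hinf_def monodromy_class_in_pi1)
  ultimately show ?thesis
    using assms(1,2) by (auto simp: Hinf_def intro: holomorphic_intros)
qed

lemma competitor_bound_mult:
  assumes "competitor_bound e x \<xi> M" "competitor_bound e x \<eta> N"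
    and "\<And>g. g \<in> carrier (pi1 e) \<Longrightarrow> \<zeta> g = \<xi> g * \<eta> g"
  shows "competitor_bound e x \<zeta> (M * N)"
proof -
  obtain f h where f: "f \<in> Hinf e x \<xi>" "f 0 = 1" "\<And>z. z \<in> ball 0 1 \<Longrightarrow> norm (f z) \<le> M"
    and h: "h \<in> Hinf e x \<eta>" "h 0 = 1" "\<And>z. z \<in> ball 0 1 \<Longrightarrow> norm (h z) \<le> N"
    using assms(1,2) unfolding competitor_bound_def by blast
  have "norm (f z * h z) \<le> M * N" if "z \<in> ball 0 1" for z
    unfolding norm_mult using f(3)[OF that] h(3)[OF that] norm_ge_zero
    by (intro mult_mono) (auto intro: order_trans[OF norm_ge_zero])
  moreover have "(\<lambda>z. f z * h z) \<in> Hinf e x \<zeta>" using Hinf_mult f h assms(3) by blast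
  ultimately show ?thesis using f h by (auto simp: competitor_bound_def intro!: bexI[of _ "\<lambda>z. f z * h z"])
qed

lemma competitor_bound_trivial:
  assumes "\<And>g. g \<in> carrier (pi1 e) \<Longrightarrow> \<xi> g = 1"
  shows "competitor_bound e x \<xi> 1"
  unfolding competitor_bound_def
  by (rule bexI[of _ "\<lambda>_. 1"]) (auto simp: Hinf_def automorphic_iff assms monodromy_class_in_pi1 intro: boundedI[of _ 1])

text \<open>
  Lower semicontinuity of the extremal norm in the character. For a finite set \<open>S\<close> of homotopy
  classes and a tolerance \<open>\<epsilon>\<close>, the normalised functions of norm at most \<open>M + \<epsilon>\<close> that are
  \<open>\<xi>\<close>-automorphic along \<open>S\<close> up to an error proportional to \<open>\<epsilon>\<close> form a closed set; the hypothesis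
  says that these sets have the finite intersection property inside a normal family. With
  \<open>\<eta> = \<xi>\<close> allowed, the lemma also yields the existence of minimizers.
\<close>
lemma competitor_bound_closure:
  assumes approx: "\<And>S \<epsilon>. finite S \<Longrightarrow> S \<subseteq> carrier (pi1 e) \<Longrightarrow> 0 < \<epsilon> \<Longrightarrow>
     \<exists>\<eta>. competitor_bound e x \<eta> (M + \<epsilon>) \<and> (\<forall>g\<in>S. norm (\<eta> g - \<xi> g) < \<epsilon>)"
  shows "competitor_bound e x \<xi> M"
proof -
  define H where "H = {f. f holomorphic_on ball 0 1 \<and> (\<forall>z\<in>ball 0 1. norm (f z) \<le> M + 1) \<and>
      (\<forall>z. z \<notin> ball 0 1 \<longrightarrow> f z = (0::complex))}"
  define I where "I = {(S, \<epsilon>). finite S \<and> S \<subseteq> carrier (pi1 e) \<and> 0 < \<epsilon> \<and> \<epsilon> \<le> (1::real)}"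
  define C where "C = (\<lambda>(S, \<epsilon>). {f :: complex \<Rightarrow> complex. f 0 = 1 \<and> (\<forall>z\<in>ball 0 1. norm (f z) \<le> M + \<epsilon>) \<and>
     (\<forall>c d. admissible_paths e x c d \<and> monodromy_class e x c d \<in> S \<longrightarrow>
        norm (f (pathfinish c) - \<xi> (monodromy_class e x c d) * f (pathstart c)) \<le> \<epsilon> * (M + 1))})"
  have M: "0 \<le> M + 1"
    using approx[of "{}" 1] competitor_bound_ge_1 by fastforce
  have "H \<inter> \<Inter>(C ` I) \<noteq> {}"
  proof (rule compact_imp_fip_image)
    show "compact H" unfolding H_def by (rule compact_bounded_holomorphic) simp
    show "closed (C i)" if "i \<in> I" for i
    proof (cases i)
      case (Pair S \<epsilon>)
      have eval: "continuous_on UNIV (\<lambda>f :: complex \<Rightarrow> complex. f z)" for z by simp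
      let ?A = "{(c, d). admissible_paths e x c d \<and> monodromy_class e x c d \<in> S}"
      have "C i = {f. f 0 = 1} \<inter> (\<Inter>z\<in>ball 0 1. {f. norm (f z) \<le> M + \<epsilon>}) \<inter>
          (\<Inter>cd\<in>?A. {f. norm (f (pathfinish (fst cd)) -
             \<xi> (monodromy_class e x (fst cd) (snd cd)) * f (pathstart (fst cd))) \<le> \<epsilon> * (M + 1)})"
        unfolding C_def Pair by auto
      moreover have "closed {f :: complex \<Rightarrow> complex. f 0 = 1}"
        by (rule closed_Collect_eq[OF eval continuous_on_const])
      moreover have "closed {f :: complex \<Rightarrow> complex. norm (f z) \<le> M + \<epsilon>}" for z
        by (rule closed_Collect_le[OF continuous_on_norm[OF eval] continuous_on_const])
      moreover have "closed {f :: complex \<Rightarrow> complex. norm (f z - k * f w) \<le> \<epsilon> * (M + 1)}" for z w k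
        by (rule closed_Collect_le[OF continuous_on_norm[OF continuous_on_diff[OF eval
              continuous_on_mult[OF continuous_on_const eval]]] continuous_on_const])
      ultimately show ?thesis by (simp only:) (intro closed_Int closed_INT ballI; assumption)
    qed
  next
    fix J assume J: "finite J" "J \<subseteq> I"
    define S where "S = (\<Union>i\<in>J. fst i)"
    define \<epsilon> where "\<epsilon> = Min (insert 1 (snd ` J))"
    have \<epsilon>: "0 < \<epsilon>" "\<epsilon> \<le> 1" "\<And>i. i \<in> J \<Longrightarrow> \<epsilon> \<le> snd i"
      using J by (auto simp: \<epsilon>_def I_def Min_gr_iff)
    have "finite (fst i) \<and> fst i \<subseteq> carrier (pi1 e)" if "i \<in> J" for i
      using subsetD[OF J(2) that] by (cases i) (simp add: I_def)
    then have S: "finite S" "S \<subseteq> carrier (pi1 e)" using J(1) by (auto simp: S_def)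
    obtain \<eta> where \<eta>: "competitor_bound e x \<eta> (M + \<epsilon>)" "\<And>g. g \<in> S \<Longrightarrow> norm (\<eta> g - \<xi> g) < \<epsilon>"
      using approx[OF S \<epsilon>(1)] by auto
    then obtain f where f: "f \<in> Hinf e x \<eta>" "f 0 = 1" "\<And>z. z \<in> ball 0 1 \<Longrightarrow> norm (f z) \<le> M + \<epsilon>"
      unfolding competitor_bound_def by blast
    define h where "h z = (if z \<in> ball 0 1 then f z else 0)" for z
    have h: "h z = f z" if "z \<in> ball 0 1" for z using that by (simp add: h_def)
    have "h \<in> H"
    proof -
      have "h holomorphic_on ball 0 1"
        using f(1) by (auto simp: Hinf_def h intro: holomorphic_transform[of f])
      moreover have "norm (h z) \<le> M + 1" if "z \<in> ball 0 1" for z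
        using f(3)[OF that] \<epsilon>(2) that by (simp add: h)
      ultimately show ?thesis by (simp add: H_def h_def)
    qed
    moreover have "h \<in> C i" if i: "i \<in> J" for i
    proof -
      have "norm (h (pathfinish c) - \<xi> g * h (pathstart c)) \<le> snd i * (M + 1)"
        if cd: "admissible_paths e x c d" and g: "g = monodromy_class e x c d" "g \<in> fst i" for c d g
      proof -
        note c = admissible_pathsD[OF cd]
        have "h (pathfinish c) = \<eta> g * h (pathstart c)"
          using f(1) cd g c by (simp add: Hinf_def automorphic_iff h)
        then have "norm (h (pathfinish c) - \<xi> g * h (pathstart c)) = norm (\<eta> g - \<xi> g) * norm (f (pathstart c))"
          using c by (simp add: h left_diff_distrib flip: norm_mult)
        also have "\<dots> \<le> snd i * (M + 1)"
        proof (intro mult_mono)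
          have "g \<in> S" using g i by (auto simp: S_def)
          then show "norm (\<eta> g - \<xi> g) \<le> snd i" using \<eta>(2) \<epsilon>(3)[OF i] by fastforce
          show "norm (f (pathstart c)) \<le> M + 1" using f(3)[OF c(1)] \<epsilon>(2) by simp
          show "0 \<le> snd i" using \<epsilon>(1) \<epsilon>(3)[OF i] by simp
        qed simp
        finally show ?thesis .
      qed
      moreover have "norm (h z) \<le> M + snd i" if "z \<in> ball 0 1" for z
        using f(3)[OF that] \<epsilon>(3)[OF i] that by (simp add: h)
      ultimately show ?thesis using f(2) by (auto simp: C_def h split: prod.splits)
    qed
    ultimately show "H \<inter> \<Inter>(C ` J) \<noteq> {}" by blast
  qed
  then obtain f where fH: "f \<in> H" and fC: "\<And>i. i \<in> I \<Longrightarrow> f \<in> C i" by blast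
  have f0: "f 0 = 1" using fC[of "({}, 1)"] by (simp add: I_def C_def)
  have fM: "norm (f z) \<le> M" if "z \<in> ball 0 1" for z
  proof (rule field_le_epsilon)
    fix \<delta> :: real assume "0 < \<delta>"
    then have "f \<in> C ({}, min 1 \<delta>)" by (intro fC) (simp add: I_def)
    then have "norm (f z) \<le> M + min 1 \<delta>" using that by (simp add: C_def)
    then show "norm (f z) \<le> M + \<delta>" by simp
  qed
  have "automorphic e x \<xi> f"
    unfolding automorphic_iff
  proof (intro allI impI)
    fix c d assume cd: "admissible_paths e x c d"
    define g where "g = monodromy_class e x c d"
    define a where "a = norm (f (pathfinish c) - \<xi> g * f (pathstart c))"
    have "a \<le> \<delta> * (M + 1)" if "0 < \<delta>" "\<delta> \<le> 1" for \<delta>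
    proof -
      have "f \<in> C ({g}, \<delta>)"
        using that cd by (intro fC) (simp add: I_def g_def monodromy_class_in_pi1)
      then show ?thesis using cd by (auto simp: C_def g_def a_def)
    qed
    then have "\<forall>\<^sub>F \<delta> in at_right 0. a \<le> \<delta> * (M + 1)"
      unfolding eventually_at_right_field by (intro exI[of _ 1]) auto
    moreover have "((\<lambda>\<delta>. \<delta> * (M + 1)) \<longlongrightarrow> 0 * (M + 1)) (at_right 0)" by (intro tendsto_intros)
    ultimately have "a \<le> 0" using tendsto_lowerbound[of _ _ "at_right (0::real)" a] by fastforce
    then show "f (pathfinish c) = \<xi> (monodromy_class e x c d) * f (pathstart c)"
      by (simp add: a_def g_def)
  qed
  then have "f \<in> Hinf e x \<xi>" using fH fM by (auto simp: Hinf_def H_def bounded_iff)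
  then show ?thesis using f0 fM unfolding competitor_bound_def by blast
qed

lemma widom_norm_minimal:
  assumes "competitor_bound e x \<xi> M"
  shows "widom_norm e x \<xi> \<le> M" and "competitor_bound e x \<xi> (widom_norm e x \<xi>)"
    and "widom_minimizer e x \<xi> 0 = 1"
proof -
  define N where "N = sup_norm ` {h \<in> Hinf e x \<xi>. h 0 = 1}"
  have bdd: "bdd_below N"
  proof (rule bdd_belowI)
    fix a assume "a \<in> N"
    then obtain h where "h \<in> Hinf e x \<xi>" "h 0 = 1" "a = sup_norm h" by (auto simp: N_def)
    then show "1 \<le> a" using norm_le_sup_norm[of h 0] by (auto simp: Hinf_def)
  qed
  have le: "Inf N \<le> M'" if M': "competitor_bound e x \<xi> M'" for M'
  proof -
    obtain h where h: "h \<in> Hinf e x \<xi>" "h 0 = 1" "\<And>z. z \<in> ball 0 1 \<Longrightarrow> norm (h z) \<le> M'"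
      using M' unfolding competitor_bound_def by blast
    then have "sup_norm h \<le> M'" by (intro sup_norm_le)
    moreover have "Inf N \<le> sup_norm h" using bdd h by (intro cInf_lower) (auto simp: N_def)
    ultimately show ?thesis by simp
  qed
  have "N \<noteq> {}" using assms by (auto simp: competitor_bound_def N_def)
  have Inf: "competitor_bound e x \<xi> (Inf N)"
  proof (rule competitor_bound_closure)
    fix S \<epsilon> assume "0 < (\<epsilon>::real)"
    then obtain a where "a \<in> N" "a < Inf N + \<epsilon>"
      using cInf_lessD[OF \<open>N \<noteq> {}\<close>, of "Inf N + \<epsilon>"] by auto
    then obtain h where h: "h \<in> Hinf e x \<xi>" "h 0 = 1" "sup_norm h < Inf N + \<epsilon>"
      by (auto simp: N_def)
    then have "norm (h z) \<le> Inf N + \<epsilon>" if "z \<in> ball 0 1" for z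
      using norm_le_sup_norm[of h z] that by (auto simp: Hinf_def)
    then have "competitor_bound e x \<xi> (Inf N + \<epsilon>)" using h unfolding competitor_bound_def by blast
    then show "\<exists>\<eta>. competitor_bound e x \<eta> (Inf N + \<epsilon>) \<and> (\<forall>g\<in>S. norm (\<eta> g - \<xi> g) < \<epsilon>)"
      using \<open>0 < \<epsilon>\<close> by (intro exI[of _ \<xi>]) simp
  qed
  then obtain f where f: "f \<in> Hinf e x \<xi>" "f 0 = 1" "\<And>z. z \<in> ball 0 1 \<Longrightarrow> norm (f z) \<le> Inf N"
    unfolding competitor_bound_def by blast
  have "sup_norm f = Inf N"
    using bdd f by (intro antisym sup_norm_le cInf_lower) (auto simp: N_def)
  then have "is_widom_minimizer e x \<xi> f" using f by (simp add: is_widom_minimizer_def N_def)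
  then have "is_widom_minimizer e x \<xi> (widom_minimizer e x \<xi>)"
    unfolding widom_minimizer_def by (rule someI[of "is_widom_minimizer e x \<xi>"])
  then have "widom_norm e x \<xi> = Inf N" and F0: "widom_minimizer e x \<xi> 0 = 1"
    by (simp_all add: is_widom_minimizer_def widom_norm_def N_def)
  then show "widom_norm e x \<xi> \<le> M" "competitor_bound e x \<xi> (widom_norm e x \<xi>)"
    "widom_minimizer e x \<xi> 0 = 1"
    using le assms Inf by auto
qed

end

section \<open>Competitors for the nonnegative powers of the Green character\<close>

lemma green_function_growth:
  assumes "green_function e G"
  obtains M where "\<And>w. w \<notin> e \<Longrightarrow> exp (- G w) * norm w \<le> M"
proof -
  obtain c where c: "c > 0"
    "\<forall>\<^sub>F z in at_infinity. norm (G z - (ln (norm z) - ln (log_capacity e))) \<le> c * norm (1 / norm z)"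
    using assms by (auto simp: green_function_def elim!: landau_o.bigE)
  then obtain b where b: "\<And>z. b \<le> norm z \<Longrightarrow>
      norm (G z - (ln (norm z) - ln (log_capacity e))) \<le> c * norm (1 / norm z)"
    by (auto simp: eventually_at_infinity)
  define R where "R = max b 1"
  have "exp (- G w) * norm w \<le> max R (exp (c + ln (log_capacity e)))" if w: "w \<notin> e" for w
  proof (cases "R \<le> norm w")
    case True
    then have w1: "1 \<le> norm w" "b \<le> norm w" by (auto simp: R_def)
    have "c * norm (1 / norm w) \<le> c * 1"
      using w1 c by (intro mult_left_mono) (auto simp: divide_simps)
    then have "- G w \<le> c + ln (log_capacity e) - ln (norm w)"
      using b[OF w1(2)] by (simp add: abs_if split: if_splits)
    then have "exp (- G w) \<le> exp (c + ln (log_capacity e) - ln (norm w))" by simp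
    also have "\<dots> = exp (c + ln (log_capacity e)) / norm w"
      using w1 by (subst exp_diff) (auto simp: exp_ln)
    finally have "exp (- G w) * norm w \<le> exp (c + ln (log_capacity e)) / norm w * norm w"
      by (rule mult_right_mono) simp
    also have "\<dots> = exp (c + ln (log_capacity e))" using w1 by auto
    finally have "exp (- G w) * norm w \<le> exp (c + ln (log_capacity e))" .
    then show ?thesis by simp
  next
    case False
    have "exp (- G w) \<le> 1" using assms w by (simp add: green_function_def less_imp_le)
    then have "exp (- G w) * norm w \<le> 1 * norm w" by (intro mult_right_mono) auto
    then show ?thesis using False by simp
  qed
  then show thesis using that by blast
qed

context uniformized_domain
begin

text \<open>
  Two points of one fibre lie in sheets over a common evenly covered set; going down along one
  sheet and up along the other is the local deck transformation \<open>\<tau>\<close>.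
\<close>
lemma local_deck_map:
  assumes "p \<in> ball 0 1" "q \<in> ball 0 1" "x p = x q"
  obtains r \<tau> where "0 < r" "ball p r \<subseteq> ball 0 1" "inj_on x (ball p r)"
    "continuous_on (ball p r) \<tau>" "\<tau> p = q" "\<tau> ` ball p r \<subseteq> ball 0 1"
    "\<And>z. z \<in> ball p r \<Longrightarrow> x (\<tau> z) = x z"
proof -
  have xp: "x p \<in> Omega e" using assms image_x by auto
  have cov: "\<forall>y\<in>Omega e. \<exists>T. y \<in> T \<and> openin (top_of_set (Omega e)) T \<and>
      (\<exists>v. \<Union>v = ball 0 1 \<inter> x -` T \<and> (\<forall>u\<in>v. openin (top_of_set (ball 0 1)) u) \<and>
        pairwise disjnt v \<and> (\<forall>u\<in>v. \<exists>k. homeomorphism u T x k))"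
    using universal_covering by (simp add: universal_covering_def covering_space_def)
  from bspec[OF cov xp] obtain T v where T: "x p \<in> T" "\<Union>v = ball 0 1 \<inter> x -` T"
    and v: "\<forall>u\<in>v. openin (top_of_set (ball 0 1)) u" "\<forall>u\<in>v. \<exists>k. homeomorphism u T x k"
    by (elim exE conjE) (rule that)
  have "p \<in> \<Union>v" "q \<in> \<Union>v" using T assms by auto
  then obtain U V where U: "U \<in> v" "p \<in> U" and V: "V \<in> v" "q \<in> V" by blast
  obtain k where k: "homeomorphism U T x k" using v U by blast
  obtain l where l: "homeomorphism V T x l" using v V by blast
  have "open U" using bspec[OF v(1) U(1)] by (simp add: openin_open_eq)
  then obtain r where r: "0 < r" "ball p r \<subseteq> U" using U openE by blast
  have UV: "U \<subseteq> ball 0 1" "V \<subseteq> ball 0 1" using T(2) U V by auto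
  show thesis
  proof (rule that[of r "l \<circ> x"])
    show "0 < r" "ball p r \<subseteq> ball 0 1" using r UV by auto
    show "inj_on x (ball p r)"
      using k r by (intro inj_on_inverseI[of _ k]) (auto simp: homeomorphism_def)
    have "continuous_on U x" "x ` U = T" using k by (auto simp: homeomorphism_def)
    moreover have "continuous_on T l" using l by (simp add: homeomorphism_def)
    ultimately have "continuous_on U (l \<circ> x)" by (metis continuous_on_compose)
    then show "continuous_on (ball p r) (l \<circ> x)" using r(2) by (rule continuous_on_subset)
    show "(l \<circ> x) p = q" using assms V l by (simp add: homeomorphism_def)
    have lx: "l (x z) \<in> V \<and> x (l (x z)) = x z" if "z \<in> ball p r" for z
    proof -
      have "x z \<in> T" using that r(2) \<open>x ` U = T\<close> by blast
      then show ?thesis using l by (auto simp: homeomorphism_def)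
    qed
    then show "(l \<circ> x) ` ball p r \<subseteq> ball 0 1" "\<And>z. z \<in> ball p r \<Longrightarrow> x ((l \<circ> x) z) = x z"
      using UV(2) by auto
  qed
qed

text \<open>
  The endpoints of a lifted loop may be moved along two lifts \<open>s\<close> and \<open>t\<close> of one path without
  changing the class at the base point: the detour \<open>s +++ c' +++ reversepath t\<close> is homotopic to
  \<open>c\<close> in the disk because the disk is simply connected.
\<close>
lemma monodromy_class_perturb:
  assumes cd: "admissible_paths e x c d"
    and s: "path s" "path_image s \<subseteq> ball 0 1" "pathstart s = pathstart c"
    and t: "path t" "path_image t \<subseteq> ball 0 1" "pathstart t = pathfinish c"
    and st: "x \<circ> t = x \<circ> s"
  defines "c' \<equiv> reversepath s +++ c +++ t" and "d' \<equiv> d +++ (x \<circ> s)"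
  shows "admissible_paths e x c' d'" and "monodromy_class e x c' d' = monodromy_class e x c d"
proof -
  have c: "path c" "path_image c \<subseteq> ball 0 1" and d: "path d" "path_image d \<subseteq> Omega e"
    "pathstart d = Infty" "pathfinish d = x (pathstart c)" and xc: "x (pathfinish c) = x (pathstart c)"
    using cd by (auto simp: admissible_paths_def)
  have proj: "path (x \<circ> p) \<and> path_image (x \<circ> p) \<subseteq> Omega e" if "path p" "path_image p \<subseteq> ball 0 1" for p
    using that image_x continuous_x
    by (auto simp: path_image_compose intro!: path_continuous_image intro: continuous_on_subset)
  have c': "path c'" "path_image c' \<subseteq> ball 0 1" "pathstart c' = pathfinish s" "pathfinish c' = pathfinish t"
    unfolding c'_def using c s t by (auto simp: path_image_join)
  have xt: "x (pathfinish t) = x (pathfinish s)"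
    using fun_cong[OF st, of 1] by (simp add: pathfinish_def)
  define \<delta> where "\<delta> = x \<circ> s"
  define X where "X = x \<circ> c'"
  have \<delta>: "path \<delta>" "path_image \<delta> \<subseteq> Omega e" "pathstart \<delta> = x (pathstart c)" "pathfinish \<delta> = x (pathfinish s)"
    using proj[OF s(1,2)] s(3) by (auto simp: \<delta>_def pathstart_compose pathfinish_compose)
  have X: "path X" "path_image X \<subseteq> Omega e" "pathstart X = x (pathfinish s)" "pathfinish X = x (pathfinish s)"
    using proj[OF c'(1,2)] c' xt by (auto simp: X_def pathstart_compose pathfinish_compose)
  show "admissible_paths e x c' d'"
    unfolding admissible_paths_def d'_def using c' d \<delta> xt by (auto simp: path_image_join \<delta>_def)
  define Y where "Y = \<delta> +++ (X +++ reversepath \<delta>)"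
  have Y: "path Y" "path_image Y \<subseteq> Omega e" "pathstart Y = x (pathstart c)" "pathfinish Y = x (pathstart c)"
    using X \<delta> by (auto simp: Y_def path_image_join)
  have "homotopic_paths (Omega e) Y (x \<circ> c)"
  proof -
    have "homotopic_paths (ball 0 1) (s +++ (c' +++ reversepath t)) c"
    proof -
      have "simply_connected (ball (0::complex) 1)" by (simp add: convex_imp_simply_connected)
      then show ?thesis
        unfolding simply_connected_eq_homotopic_paths
        using s t c c' by (auto simp: path_image_join)
    qed
    then have "homotopic_paths (Omega e) (x \<circ> (s +++ (c' +++ reversepath t))) (x \<circ> c)"
      by (rule homotopic_paths_continuous_image) (use continuous_x image_x in auto)
    also have "x \<circ> (s +++ (c' +++ reversepath t)) = Y"
      by (simp add: Y_def X_def \<delta>_def path_compose_join path_compose_reversepath st)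
    finally show ?thesis .
  qed
  have "homotopic_paths (Omega e) ((d +++ \<delta>) +++ (X +++ (reversepath \<delta> +++ reversepath d)))
      (d +++ (\<delta> +++ (X +++ (reversepath \<delta> +++ reversepath d))))"
    using d \<delta> X by (intro homotopic_paths_sym[OF homotopic_paths_assoc]) (auto simp: path_image_join)
  also have "homotopic_paths (Omega e) \<dots>
      (d +++ (\<delta> +++ ((X +++ reversepath \<delta>) +++ reversepath d)))"
    using d \<delta> X by (intro homotopic_paths_join homotopic_paths_assoc) (auto simp: path_image_join)
  also (homotopic_paths_trans) have "homotopic_paths (Omega e) \<dots> (d +++ (Y +++ reversepath d))"
    unfolding Y_def
    using d \<delta> X by (intro homotopic_paths_join homotopic_paths_assoc) (auto simp: path_image_join)
  also (homotopic_paths_trans) have "homotopic_paths (Omega e) \<dots> (d +++ ((x \<circ> c) +++ reversepath d))"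
    using d Y \<open>homotopic_paths (Omega e) Y (x \<circ> c)\<close>
    by (intro homotopic_paths_join) auto
  finally (homotopic_paths_trans) have "homotopic_paths (Omega e) (d' +++ X +++ reversepath d') (d +++ (x \<circ> c) +++ reversepath d)"
    using d \<delta> by (simp add: d'_def \<delta>_def reversepath_joinpaths)
  then show "monodromy_class e x c' d' = monodromy_class e x c d"
    unfolding monodromy_class_def X_def by (rule path_class_cong)
qed

text \<open>
  A function given by a formula that breaks down over a single point \<open>w\<close>, such as the product of
  a zero and a pole, need only be tested over the other points: the endpoints of \<open>c\<close> are moved off
  the fibre and the relation is recovered as a limit.
\<close>
lemma automorphic_off_fibre:
  assumes cont: "continuous_on (ball 0 1) f"
    and off: "\<And>c d. admissible_paths e x c d \<Longrightarrow> x (pathstart c) \<noteq> w \<Longrightarrow>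
      f (pathfinish c) = \<xi> (monodromy_class e x c d) * f (pathstart c)"
  shows "automorphic e x \<xi> f"
  unfolding automorphic_iff
proof (intro allI impI)
  fix c d assume cd: "admissible_paths e x c d"
  define p q \<kappa> where "p = pathstart c" and "q = pathfinish c" and "\<kappa> = \<xi> (monodromy_class e x c d)"
  have p: "p \<in> ball 0 1" and q: "q \<in> ball 0 1" and xpq: "x p = x q"
    using admissible_pathsD[OF cd] cd by (auto simp: p_def q_def admissible_paths_def)
  show "f (pathfinish c) = \<xi> (monodromy_class e x c d) * f (pathstart c)"
  proof (cases "x p = w")
    case False
    then show ?thesis using off cd by (simp add: p_def)
  next
    case True
    obtain r \<tau> where r: "0 < r" "ball p r \<subseteq> ball 0 1" "inj_on x (ball p r)"
      and \<tau>: "continuous_on (ball p r) \<tau>" "\<tau> p = q" "\<tau> ` ball p r \<subseteq> ball 0 1"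
        "\<And>z. z \<in> ball p r \<Longrightarrow> x (\<tau> z) = x z"
      using local_deck_map[OF p q xpq] by blast
    have eq: "f (\<tau> z) = \<kappa> * f z" if z: "z \<in> ball p r" "z \<noteq> p" for z
    proof -
      define s where "s = linepath p z"
      have seg: "path_image s \<subseteq> ball p r"
        using z r by (simp add: s_def closed_segment_subset)
      have sI: "s u \<in> ball p r" if "u \<in> {0..1}" for u
        using seg that unfolding path_image_def by blast
      define t where "t u = (if u \<in> {0..1} then \<tau> (s u) else s u)" for u
      have t\<tau>: "t u = (\<tau> \<circ> s) u" if "u \<in> {0..1}" for u using that by (simp add: t_def)
      have xts: "x \<circ> t = x \<circ> s"
        using \<tau>(4) sI by (auto simp: t_def fun_eq_iff)
      have "path (\<tau> \<circ> s)"
        using \<tau>(1) seg by (intro path_continuous_image) (auto simp: s_def intro: continuous_on_subset)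
      then have pt: "path t" by (rule path_eq) (simp add: t\<tau>)
      have ti: "path_image t \<subseteq> ball 0 1"
        using t\<tau> sI \<tau>(3) by (auto simp: path_image_def)
      have ends: "pathstart t = q" "pathfinish t = \<tau> z" "pathstart s = p" "pathfinish s = z" 
        using \<tau>(2) by (auto simp: t_def s_def pathstart_def pathfinish_def linepath_def)
      have ps: "path s" by (simp add: s_def)
      let ?c = "reversepath s +++ c +++ t" and ?d = "d +++ (x \<circ> s)"
      have "admissible_paths e x ?c ?d" "monodromy_class e x ?c ?d = monodromy_class e x c d"
        using monodromy_class_perturb[OF cd ps _ _ pt ti _ xts] order_trans[OF seg r(2)] ends
        by (simp_all add: p_def q_def)
      moreover have "x z \<noteq> w"
        using inj_onD[OF r(3), of z p] z True r(1) by auto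
      ultimately show ?thesis
        using off[of ?c ?d] ends by (simp add: \<kappa>_def)
    qed
    have near: "\<forall>\<^sub>F z in at p. z \<in> ball p r \<and> z \<noteq> p"
      using r(1) by (auto simp: eventually_at dist_commute intro!: exI[of _ r])
    have "(\<lambda>z. f (\<tau> z)) \<midarrow>p\<rightarrow> f q"
    proof -
      have "continuous_on (ball p r) (f \<circ> \<tau>)"
        using \<tau> cont by (intro continuous_on_compose) (auto intro: continuous_on_subset)
      then have "isCont (f \<circ> \<tau>) p" using r(1) by (simp add: continuous_on_eq_continuous_at o_def)
      then show ?thesis using \<tau>(2) by (simp add: isCont_def o_def)
    qed
    moreover have "(\<lambda>z. f (\<tau> z)) \<midarrow>p\<rightarrow> \<kappa> * f p"
    proof (rule Lim_transform_eventually)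
      have "isCont f p" using cont p by (simp add: continuous_on_eq_continuous_at)
      then show "(\<lambda>z. \<kappa> * f z) \<midarrow>p\<rightarrow> \<kappa> * f p" by (intro tendsto_intros) (simp add: isCont_def)
      show "\<forall>\<^sub>F z in at p. \<kappa> * f z = f (\<tau> z)"
        using near by eventually_elim (simp add: eq)
    qed
    ultimately have "f q = \<kappa> * f p" by (rule LIM_unique)
    then show ?thesis by (simp add: p_def q_def \<kappa>_def)
  qed
qed

text \<open>
  The complex Green's function vanishes exactly where the covering map has its poles, and to the
  same order. Its product with the covering map is bounded because \<open>exp (- G w)\<close> decays like
  \<open>1 / norm w\<close>, so the singularities are removable, and at the base point the product is the
  capacity, in particular not 0.
\<close>
lemma complex_green_times_coordinate:
  assumes G: "green_function e G" and B: "complex_green e G x B"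
  obtains h M where "h holomorphic_on ball 0 1" "\<And>z. z \<in> ball 0 1 \<Longrightarrow> norm (h z) \<le> M"
    "\<And>z. z \<in> ball 0 1 \<Longrightarrow> x z \<noteq> Infty \<Longrightarrow> h z = B z * affine (x z)"
    "h 0 = of_real (log_capacity e)"
proof -
  define u where "u z = B z * affine (x z)" for z
  define \<Omega> where "\<Omega> = {z \<in> ball 0 1. x z \<noteq> Infty}"
  have "open \<Omega>"
  proof -
    have "Fin -` range Fin = UNIV" by auto
    then have "open (range Fin)" by (auto simp: open_riemann_sphere_def)
    then have op: "open (ball 0 1 \<inter> x -` range Fin)"
      using continuous_x by (intro continuous_open_preimage) auto
    have "x z \<in> range Fin \<longleftrightarrow> x z \<noteq> Infty" for z by (cases "x z") auto
    then have "ball 0 1 \<inter> x -` range Fin = \<Omega>" by (auto simp: \<Omega>_def)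
    then show ?thesis using op by simp
  qed
  have u_hol: "u holomorphic_on \<Omega>"
    unfolding u_def
  proof (intro holomorphic_on_mult)
    show "B holomorphic_on \<Omega>" using B by (auto simp: complex_green_def \<Omega>_def intro: holomorphic_on_subset)
    show "(\<lambda>z. affine (x z)) holomorphic_on \<Omega>"
      using universal_covering by (simp add: universal_covering_def sphere_holomorphic_on_def \<Omega>_def)
  qed
  obtain M where M: "\<And>w. w \<notin> e \<Longrightarrow> exp (- G w) * norm w \<le> M"
    using green_function_growth[OF G] by blast
  have uM: "norm (u z) \<le> M" if z: "z \<in> \<Omega>" for z
  proof -
    obtain w where w: "x z = Fin w" using z by (cases "x z") (auto simp: \<Omega>_def)
    have "Fin w \<in> Omega e" using that w image_x by (force simp: \<Omega>_def)
    then have "w \<notin> e" by (auto simp: Omega_def)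
    moreover have "norm (B z) = exp (- G w)" using B that w by (simp add: complex_green_def \<Omega>_def)
    ultimately show ?thesis using M w by (simp add: u_def norm_mult)
  qed
  define h where "h = remove_sings u"
  have hu: "h z = u z" if "z \<in> \<Omega>" for z
    using that u_hol \<open>open \<Omega>\<close> analytic_at unfolding h_def by (intro remove_sings_at_analytic) blast
  have isolated: "\<exists>r>0. ball p r - {p} \<subseteq> \<Omega>" if p: "p \<in> ball 0 1" "p \<notin> \<Omega>" for p
  proof -
    have xp: "x p = Infty" using p by (simp add: \<Omega>_def)
    obtain r where r: "0 < r" "ball p r \<subseteq> ball 0 1" "inj_on x (ball p r)"
      using local_deck_map[OF p(1) p(1)] by metis
    have "z \<in> \<Omega>" if z: "z \<in> ball p r - {p}" for z
    proof -
      have "x z \<noteq> Infty" using inj_onD[OF r(3), of z p] xp r(1) z by auto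
      then show ?thesis using z r(2) by (auto simp: \<Omega>_def)
    qed
    then show ?thesis using r(1) by blast
  qed
  have loc: "\<exists>S. open S \<and> p \<in> S \<and> h holomorphic_on S" if p: "p \<in> ball 0 1" for p
  proof (cases "p \<in> \<Omega>")
    case True
    then show ?thesis using u_hol hu \<open>open \<Omega>\<close> holomorphic_transform by (metis (no_types, lifting))
  next
    case False
    then obtain r where r: "0 < r" and sub: "ball p r - {p} \<subseteq> \<Omega>" using isolated p by blast
    have near: "\<forall>\<^sub>F z in at p. z \<in> ball p r - {p}"
      using r by (auto simp: eventually_at dist_commute intro!: exI[of _ r])
    have "\<forall>\<^sub>F z in at p. norm (u z) \<le> M"
      using near by eventually_elim (use sub uM in blast)
    then obtain g where g: "g holomorphic_on ball p r" "\<And>z. z \<in> ball p r - {p} \<Longrightarrow> g z = u z"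
      using holomorphic_on_extend_bounded[of u "ball p r" p] holomorphic_on_subset[OF u_hol sub] r
      by auto
    have "g \<midarrow>p\<rightarrow> g p"
      using g(1) r holomorphic_on_imp_continuous_on[OF g(1)]
      by (simp add: continuous_on_eq_continuous_at isContD)
    moreover have "\<forall>\<^sub>F z in at p. g z = u z" using near by eventually_elim (rule g(2))
    ultimately have "u \<midarrow>p\<rightarrow> g p" by (rule Lim_transform_eventually)
    then have "h p = g p" unfolding h_def by (rule remove_sings_eqI)
    then have "h z = g z" if "z \<in> ball p r" for z
      using that g(2)[of z] hu[of z] sub by (cases "z = p") auto
    then have "h holomorphic_on ball p r" using g(1) holomorphic_transform by metis
    then show ?thesis using r by (intro exI[of _ "ball p r"]) auto
  qed
  have hol: "h holomorphic_on ball 0 1"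
  proof (rule analytic_imp_holomorphic)
    show "h analytic_on ball 0 1"
      unfolding analytic_on_analytic_at[of h "ball 0 1"] using loc by (auto simp: analytic_at)
  qed
  have hM: "norm (h z) \<le> M" if z: "z \<in> ball 0 1" for z
  proof (cases "z \<in> \<Omega>")
    case True
    then show ?thesis using hu uM by simp
  next
    case False
    then obtain r where r: "0 < r" and sub: "ball z r - {z} \<subseteq> \<Omega>" using isolated z by blast
    have "\<forall>\<^sub>F w in at z. w \<in> ball z r - {z}"
      using r by (auto simp: eventually_at dist_commute intro!: exI[of _ r])
    then have "\<forall>\<^sub>F w in at z. norm (h w) \<le> M"
      by eventually_elim (use sub hu uM in auto)
    moreover have "h \<midarrow>z\<rightarrow> h z"
      using holomorphic_on_imp_continuous_on[OF hol] z
      by (simp add: continuous_on_eq_continuous_at isContD)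
    ultimately show ?thesis by (intro tendsto_upperbound[OF tendsto_norm]) auto
  qed
  have "u \<midarrow>0\<rightarrow> of_real (log_capacity e)"
  proof -
    define a where "a z = affine (x z)" for z
    define C where "C = (of_real (log_capacity e) :: complex)"
    obtain D where D: "D > 0" "(\<lambda>z. a z - of_real D / z) \<in> O[at 0](\<lambda>_. 1)"
      using universal_covering by (auto simp: universal_covering_def a_def)
    obtain k where k: "\<forall>\<^sub>F z in at 0. norm (a z - of_real D / z) \<le> k"
      using D(2) by (auto elim!: landau_o.bigE)
    \<comment> \<open>The normalisation of the covering map says that \<open>a\<close> has a simple pole at 0.\<close>
    have za: "(\<lambda>z. z * a z) \<midarrow>0\<rightarrow> of_real D"
    proof -
      have "((\<lambda>z. z * a z - of_real D) \<longlongrightarrow> 0) (at 0)"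
      proof (rule Lim_null_comparison)
        show "\<forall>\<^sub>F z in at 0. norm (z * a z - of_real D) \<le> norm z * k"
          using k eventually_neq_at_within[of 0 0 UNIV]
        proof eventually_elim
          case (elim z)
          then have "z * a z - of_real D = z * (a z - of_real D / z)" by (simp add: algebra_simps)
          then show ?case using elim by (simp add: norm_mult mult_left_mono)
        qed
        have "((\<lambda>z::complex. norm z * k) \<longlongrightarrow> norm (0::complex) * k) (at 0)" by (intro tendsto_intros)
        then show "((\<lambda>z::complex. norm z * k) \<longlongrightarrow> 0) (at 0)" by simp
      qed
      then show ?thesis by (simp add: LIM_zero_iff)
    qed
    have a_nz: "\<forall>\<^sub>F z in at 0. a z \<noteq> 0"
      using tendsto_imp_eventually_ne[OF za, of 0] D(1) by (auto elim!: eventually_mono)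
    have inv: "((\<lambda>z. 1 / a z) \<longlongrightarrow> 0) (at 0)"
    proof (rule Lim_transform_eventually)
      have "((\<lambda>z. z / (z * a z)) \<longlongrightarrow> 0 / of_real D) (at 0)"
        using za D(1) by (intro tendsto_intros) auto
      then show "((\<lambda>z. z / (z * a z)) \<longlongrightarrow> 0) (at 0)" by simp
      show "\<forall>\<^sub>F z in at 0. z / (z * a z) = 1 / a z"
        using eventually_neq_at_within[of 0 0 UNIV] by eventually_elim simp
    qed
    obtain l where l: "\<forall>\<^sub>F z in at 0. norm (B z - C / a z) \<le> l * norm (1 / a z ^ 2)"
      using B by (auto simp: complex_green_def a_def C_def elim!: landau_o.bigE)
    have "((\<lambda>z. u z - C) \<longlongrightarrow> 0) (at 0)"
    proof (rule Lim_null_comparison)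
      show "\<forall>\<^sub>F z in at 0. norm (u z - C) \<le> l * norm (1 / a z)"
        using l a_nz
      proof eventually_elim
        case (elim z)
        have "norm (u z - C) = norm (a z) * norm (B z - C / a z)"
          using elim(2) by (simp add: u_def a_def[symmetric] algebra_simps flip: norm_mult)
        also have "\<dots> \<le> norm (a z) * (l * norm (1 / a z ^ 2))"
          using elim(1) by (intro mult_left_mono) auto
        also have "\<dots> = l * norm (1 / a z)"
          using elim(2) by (simp add: norm_divide norm_mult power2_eq_square)
        finally show ?case .
      qed
      show "((\<lambda>z. l * norm (1 / a z)) \<longlongrightarrow> 0) (at 0)"
        using tendsto_mult_left[OF tendsto_norm[OF inv], of l] by simp
    qed
    then show ?thesis by (simp add: LIM_zero_iff C_def)
  qed
  then have "h 0 = of_real (log_capacity e)" unfolding h_def by (rule remove_sings_eqI)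
  then show thesis
    using that[of h M] hol hM hu by (simp add: \<Omega>_def u_def)
qed

text \<open>
  Since the covering map is invariant, multiplying by it does not change the character; the
  \<open>n\<close>-th power of the normalised product is a competitor for \<open>\<xi>\<^sup>n\<close>.
\<close>
lemma competitor_bound_nonneg_power:
  assumes G: "green_function e G" and B: "complex_green e G x B"
    and \<xi>: "is_character_of e x B \<xi>" and cap: "log_capacity e > 0"
  shows "\<exists>M. competitor_bound e x (char_power e \<xi> (int n)) M"
proof (induction n)
  case 0
  show ?case by (rule exI[of _ 1], rule competitor_bound_trivial) (simp add: char_power_def)
next
  case (Suc n)
  obtain h M where h: "h holomorphic_on ball 0 1" "\<And>z. z \<in> ball 0 1 \<Longrightarrow> norm (h z) \<le> M"
    "\<And>z. z \<in> ball 0 1 \<Longrightarrow> x z \<noteq> Infty \<Longrightarrow> h z = B z * affine (x z)"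
    "h 0 = of_real (log_capacity e)"
    using complex_green_times_coordinate[OF G B] by blast
  define k where "k z = h z / of_real (log_capacity e)" for z
  have "automorphic e x \<xi> k"
  proof (rule automorphic_off_fibre[where w = Infty])
    show "continuous_on (ball 0 1) k"
      unfolding k_def using h(1) cap
      by (intro continuous_intros holomorphic_on_imp_continuous_on) auto
    fix c d assume cd: "admissible_paths e x c d" "x (pathstart c) \<noteq> Infty"
    then have "B (pathfinish c) = \<xi> (monodromy_class e x c d) * B (pathstart c)"
      "x (pathfinish c) = x (pathstart c)"
      using \<xi> by (auto simp: is_character_of_def automorphic_iff admissible_paths_def)
    then show "k (pathfinish c) = \<xi> (monodromy_class e x c d) * k (pathstart c)"
      using admissible_pathsD[OF cd(1)] cd(2) by (simp add: k_def h(3))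
  qed
  moreover have kM: "norm (k z) \<le> M / log_capacity e" if "z \<in> ball 0 1" for z
    using h(2)[OF that] cap by (simp add: k_def norm_divide divide_right_mono)
  moreover have "k holomorphic_on ball 0 1"
    unfolding k_def using h(1) cap by (intro holomorphic_intros) auto
  ultimately have "k \<in> Hinf e x \<xi>"
    by (auto simp: Hinf_def intro: boundedI[of _ "M / log_capacity e"])
  moreover have "k 0 = 1" using cap by (simp add: k_def h(4))
  ultimately have "competitor_bound e x \<xi> (M / log_capacity e)"
    using kM unfolding competitor_bound_def by blast
  moreover obtain N where "competitor_bound e x (char_power e \<xi> (int n)) N" using Suc by blast
  ultimately have "competitor_bound e x (char_power e \<xi> (int (Suc n))) (M / log_capacity e * N)"
    by (rule competitor_bound_mult) (simp add: char_power_def del: of_nat_Suc)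
  then show ?case by blast
qed

end

section \<open>From the powers of a generator to all characters\<close>

text \<open>
  At the outset only the nonnegative powers are known to have competitors. For negative \<open>n\<close> the norm
  in the last assumption is that of an arbitrary function until a competitor has been found.
\<close>
locale bounded_widom_powers = uniformized_domain +
  fixes \<xi> :: sphere_character and M\<^sub>0 :: real
  assumes character: "\<xi> \<in> characters e"
    and generator: "canonical_generator e \<xi>"
    and nonneg_powers: "\<And>n. \<exists>M. competitor_bound e x (char_power e \<xi> (int n)) M"
    and widom_norm_le: "\<And>n. widom_norm e x (char_power e \<xi> n) \<le> M\<^sub>0"
begin

lemma power_near:
  assumes "openin (character_topology e) W" "\<psi> \<in> W"
  obtains n where "char_power e \<xi> n \<in> W"
proof -
  have "\<psi> \<in> topspace (character_topology e)" using assms openin_subset by blast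
  then have "\<psi> \<in> character_topology e closure_of range (char_power e \<xi>)"
    using generator by (simp add: canonical_generator_def)
  then show thesis using assms that unfolding in_closure_of by blast
qed

lemma power_approximates:
  assumes "openin (character_topology e) W" "\<psi> \<in> W" "finite S" "S \<subseteq> carrier (pi1 e)" "0 < \<epsilon>"
  obtains n where "char_power e \<xi> n \<in> W" "\<And>g. g \<in> S \<Longrightarrow> norm (char_power e \<xi> n g - \<psi> g) < \<epsilon>"
proof -
  have "\<psi> \<in> characters e" using assms openin_subset topspace_character_topology by blast
  then obtain n where "char_power e \<xi> n \<in> W \<inter> {\<eta> \<in> characters e. \<forall>g\<in>S. norm (\<eta> g - \<psi> g) < \<epsilon>}"
    using power_near[OF openin_Int[OF assms(1) openin_character_nbhd[OF assms(3,4), of \<psi> \<epsilon>]], of \<psi>] assms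
    by auto
  then show thesis using that by blast
qed

text \<open>
  The nonnegative powers are already dense: a power \<open>n\<close>, possibly negative, that is close to
  \<open>\<psi>\<close> on finitely many classes may be replaced by \<open>n + p\<close>, where \<open>p \<ge> \<bar>n\<bar>\<close> is a time at which
  the powers nearly return to the trivial character. The uniform bound then passes to the limit.
\<close>
lemma competitor_bound_all:
  assumes "\<psi> \<in> characters e"
  shows "competitor_bound e x \<psi> M\<^sub>0"
proof (rule competitor_bound_closure)
  fix S \<epsilon> assume S: "finite S" "S \<subseteq> carrier (pi1 e)" and \<epsilon>: "0 < (\<epsilon>::real)"
  have op: "openin (character_topology e) (characters e)" by (simp flip: topspace_character_topology)
  obtain n where n: "\<And>g. g \<in> S \<Longrightarrow> norm (char_power e \<xi> n g - \<psi> g) < \<epsilon>/2"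
    using power_approximates[OF op assms S half_gt_zero[OF \<epsilon>]] by blast
  have unit: "norm (\<xi> g) = 1" if "g \<in> S" for g using norm_character[OF character] that S by blast
  obtain p where p: "nat \<bar>n\<bar> \<le> p" "\<And>g. g \<in> S \<Longrightarrow> norm (\<xi> g ^ p - 1) < \<epsilon>/2"
    using simultaneous_recurrence[where u = \<xi> and N = "nat \<bar>n\<bar>", OF S(1) unit half_gt_zero[OF \<epsilon>]]
    by blast
  define k where "k = nat (n + int p)"
  have k: "int k = n + int p" using p(1) by (simp add: k_def)
  have near: "norm (char_power e \<xi> (int k) g - \<psi> g) < \<epsilon>" if g: "g \<in> S" for g
  proof -
    have gc: "g \<in> carrier (pi1 e)" and "\<xi> g \<noteq> 0" using g S unit by force+
    then have "char_power e \<xi> (int k) g - char_power e \<xi> n g = \<xi> g powi n * (\<xi> g ^ p - 1)"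
      by (simp add: char_power_def k power_int_add algebra_simps)
    then have "norm (char_power e \<xi> (int k) g - char_power e \<xi> n g) < \<epsilon>/2"
      using p(2)[OF g] unit[OF g] by (simp add: norm_mult norm_power_int)
    then show ?thesis using n[OF g] by (rule norm_diff_triangle_less[THEN less_le_trans]) simp
  qed
  have "competitor_bound e x (char_power e \<xi> (int k)) (widom_norm e x (char_power e \<xi> (int k)))"
    using nonneg_powers widom_norm_minimal(2) by blast
  then have "competitor_bound e x (char_power e \<xi> (int k)) (M\<^sub>0 + \<epsilon>)"
    by (rule competitor_bound_mono) (use widom_norm_le[of "int k"] \<epsilon> in simp)
  then show "\<exists>\<eta>. competitor_bound e x \<eta> (M\<^sub>0 + \<epsilon>) \<and> (\<forall>g\<in>S. norm (\<eta> g - \<psi> g) < \<epsilon>)"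
    using near by blast
qed

lemma competitor_bound_widom_norm:
  assumes "\<psi> \<in> characters e"
  shows "competitor_bound e x \<psi> (widom_norm e x \<psi>)"
  using competitor_bound_all[OF assms] by (rule widom_norm_minimal(2))

text \<open>
  Continuity of the extremal norm at the trivial character. Along the filter of those \<open>n\<close> for which
  \<open>\<xi>\<^sup>n\<close> tends to the trivial character, the norms \<open>f\<close> are lower semicontinuous at every \<open>m\<close>, since
  \<open>\<xi>\<^sup>m\<^sup>+\<^sup>n\<close> tends to \<open>\<xi>\<^sup>m\<close>; almost periodicity turns this into \<open>f n < f 0 + \<epsilon>\<close>, and \<open>f 0 \<le> 1\<close>
  because of the constant function 1. A last passage to the limit extends the bound from powers
  to all characters in the neighbourhood.
\<close>
lemma widom_norm_near_trivial:
  assumes ap: "almost_periodic (\<lambda>n. widom_norm e x (char_power e \<xi> n))" and \<epsilon>: "0 < \<epsilon>"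
  obtains W where "openin (character_topology e) W" "char_power e \<xi> 0 \<in> W"
    "\<And>\<psi>. \<psi> \<in> W \<Longrightarrow> competitor_bound e x \<psi> (1 + \<epsilon>)"
proof -
  define f where "f n = widom_norm e x (char_power e \<xi> n)" for n
  define one where "one = char_power e \<xi> 0"
  have one: "one \<in> characters e" using char_power_in_characters[OF character] by (simp add: one_def)
  define F where "F = filtercomap (char_power e \<xi>) (nhdsin (character_topology e) one)"
  have lsc: "\<forall>\<^sub>F n in F. f m - \<eta> < f (m + n)" if \<eta>: "0 < \<eta>" for m \<eta>
  proof (rule ccontr)
    assume "\<not> ?thesis"
    then have freq: "\<exists>\<^sub>F n in F. f (m + n) \<le> f m - \<eta>" by (simp add: not_eventually not_less)
    have "competitor_bound e x (char_power e \<xi> m) (f m - \<eta>)"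
    proof (rule competitor_bound_closure)
      fix S \<epsilon> assume S: "finite S" "S \<subseteq> carrier (pi1 e)" and \<epsilon>: "0 < (\<epsilon>::real)"
      define V where "V = {\<eta> \<in> characters e. \<forall>g\<in>S. norm (\<eta> g - one g) < \<epsilon>}"
      have "openin (character_topology e) V" unfolding V_def by (rule openin_character_nbhd[OF S])
      moreover have "one \<in> V" using one \<epsilon> by (simp add: V_def)
      ultimately have "\<forall>\<^sub>F \<psi> in nhdsin (character_topology e) one. \<psi> \<in> V"
        unfolding eventually_nhdsin by blast
      then have "\<forall>\<^sub>F n in F. char_power e \<xi> n \<in> V"
        unfolding F_def by (rule eventually_filtercomapI)
      then obtain n where n: "f (m + n) \<le> f m - \<eta>" "char_power e \<xi> n \<in> V"
        using frequently_ex[OF frequently_eventually_conj[OF freq]] by blast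
      have near: "norm (char_power e \<xi> (m + n) g - char_power e \<xi> m g) < \<epsilon>" if g: "g \<in> S" for g
      proof -
        have gc: "g \<in> carrier (pi1 e)" and unit: "norm (\<xi> g) = 1"
          using g S norm_character[OF character] by auto
        then have "\<xi> g \<noteq> 0" by auto
        then have "char_power e \<xi> (m + n) g - char_power e \<xi> m g =
            \<xi> g powi m * (char_power e \<xi> n g - one g)"
          using gc by (simp add: char_power_def one_def power_int_add algebra_simps)
        moreover have "norm (char_power e \<xi> n g - one g) < \<epsilon>" using n(2) g by (simp add: V_def)
        ultimately show ?thesis using unit by (simp add: norm_mult norm_power_int)
      qed
      have "competitor_bound e x (char_power e \<xi> (m + n)) (f (m + n))"
        unfolding f_def by (intro competitor_bound_widom_norm char_power_in_characters character)
      then have "competitor_bound e x (char_power e \<xi> (m + n)) (f m - \<eta> + \<epsilon>)"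
        by (rule competitor_bound_mono) (use n(1) \<epsilon> in simp)
      then show "\<exists>\<psi>. competitor_bound e x \<psi> (f m - \<eta> + \<epsilon>) \<and>
          (\<forall>g\<in>S. norm (\<psi> g - char_power e \<xi> m g) < \<epsilon>)"
        using near by blast
    qed
    then have "f m \<le> f m - \<eta>" using widom_norm_minimal(1) by (simp add: f_def)
    then show False using \<eta> by simp
  qed
  have "f 0 \<le> 1"
    unfolding f_def by (rule widom_norm_minimal(1), rule competitor_bound_trivial) (simp add: char_power_def)
  have "\<forall>\<^sub>F n in F. f n < f 0 + \<epsilon>"
    using ap lsc \<epsilon> unfolding f_def by (rule almost_periodic_lsc_imp_usc)
  then obtain W where W: "openin (character_topology e) W" "one \<in> W"
    "\<And>n. char_power e \<xi> n \<in> W \<Longrightarrow> f n < f 0 + \<epsilon>"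
    using one unfolding F_def eventually_filtercomap eventually_nhdsin topspace_character_topology by blast
  have "competitor_bound e x \<psi> (1 + \<epsilon>)" if \<psi>: "\<psi> \<in> W" for \<psi>
  proof (rule competitor_bound_closure)
    fix S \<delta> assume S: "finite S" "S \<subseteq> carrier (pi1 e)" and \<delta>: "0 < (\<delta>::real)"
    obtain n where n: "char_power e \<xi> n \<in> W" "\<And>g. g \<in> S \<Longrightarrow> norm (char_power e \<xi> n g - \<psi> g) < \<delta>"
      using power_approximates[OF W(1) \<psi> S \<delta>] by blast
    have "competitor_bound e x (char_power e \<xi> n) (f n)"
      unfolding f_def by (intro competitor_bound_widom_norm char_power_in_characters character)
    then have "competitor_bound e x (char_power e \<xi> n) (1 + \<epsilon> + \<delta>)"
      by (rule competitor_bound_mono) (use W(3)[OF n(1)] \<open>f 0 \<le> 1\<close> \<delta> in simp)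
    then show "\<exists>\<eta>. competitor_bound e x \<eta> (1 + \<epsilon> + \<delta>) \<and> (\<forall>g\<in>S. norm (\<eta> g - \<psi> g) < \<delta>)"
      using n(2) by blast
  qed
  then show thesis using that W(1,2) by (simp add: one_def)
qed

text \<open>
  A competitor for \<open>\<xi>2\<close> times one for the quotient \<open>\<xi>1 / \<xi>2\<close> is a competitor for \<open>\<xi>1\<close>.
\<close>
lemma widom_norm_ratio:
  assumes "\<xi>1 \<in> characters e" "\<xi>2 \<in> characters e"
    and "competitor_bound e x (char_quotient e \<xi>1 \<xi>2) c"
  shows "inverse (widom_norm e x \<xi>2) \<le> c * inverse (widom_norm e x \<xi>1)"
    and "1 \<le> widom_norm e x \<xi>1" "1 \<le> widom_norm e x \<xi>2"
proof -
  have "competitor_bound e x \<xi>1 (c * widom_norm e x \<xi>2)"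
  proof (rule competitor_bound_mult[OF assms(3) competitor_bound_widom_norm[OF assms(2)]])
    fix g assume g: "g \<in> carrier (pi1 e)"
    then have "\<xi>2 g \<noteq> 0" using norm_character[OF assms(2)] by force
    then show "\<xi>1 g = char_quotient e \<xi>1 \<xi>2 g * \<xi>2 g" using g by (simp add: char_quotient_def)
  qed
  then have "widom_norm e x \<xi>1 \<le> c * widom_norm e x \<xi>2" by (rule widom_norm_minimal(1))
  moreover show "1 \<le> widom_norm e x \<xi>1" "1 \<le> widom_norm e x \<xi>2"
    using assms competitor_bound_widom_norm competitor_bound_ge_1 by blast+
  ultimately show "inverse (widom_norm e x \<xi>2) \<le> c * inverse (widom_norm e x \<xi>1)"
    by (simp add: field_simps)
qed

text \<open>
  Near \<open>\<psi>\<close> both quotients with \<open>\<psi>\<close> are near the trivial character, where the norm is at most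
  \<open>1 + \<epsilon>\<close>; submultiplicativity squeezes the norm between \<open>1 / (1 + \<epsilon>)\<close> and \<open>1 + \<epsilon>\<close> times its
  value at \<open>\<psi>\<close>. Norms are at least 1, so this controls the reciprocals additively.
\<close>
lemma continuous_map_inverse_widom_norm:
  assumes ap: "almost_periodic (\<lambda>n. widom_norm e x (char_power e \<xi> n))"
  shows "continuous_map (character_topology e) euclideanreal (\<lambda>\<psi>. inverse (widom_norm e x \<psi>))"
proof -
  define q where "q \<psi> = inverse (widom_norm e x \<psi>)" for \<psi>
  have near: "\<exists>V. openin (character_topology e) V \<and> \<psi> \<in> V \<and> (\<forall>\<eta>\<in>V. \<bar>q \<eta> - q \<psi>\<bar> \<le> \<epsilon>)"
    if \<psi>: "\<psi> \<in> characters e" and \<epsilon>: "0 < \<epsilon>" for \<psi> \<epsilon>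
  proof -
    obtain W where W: "openin (character_topology e) W" "char_power e \<xi> 0 \<in> W"
      "\<And>\<eta>. \<eta> \<in> W \<Longrightarrow> competitor_bound e x \<eta> (1 + \<epsilon>)"
      using widom_norm_near_trivial[OF ap \<epsilon>] by blast
    have nz: "\<eta> g \<noteq> 0" if "\<eta> \<in> characters e" "g \<in> carrier (pi1 e)" for \<eta> g
      using norm_character[OF that] by force
    have quot: "continuous_map (character_topology e) euclidean (\<lambda>\<eta>. \<eta> g / \<psi> g)"
      "continuous_map (character_topology e) euclidean (\<lambda>\<eta>. \<psi> g / \<eta> g)"
      if g: "g \<in> carrier (pi1 e)" for g
      using continuous_map_character_eval[OF g] nz[OF _ g] \<psi>
      unfolding continuous_map_atin limitin_canonical_iff topspace_character_topology
      by (auto intro!: tendsto_divide)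
    have cont1: "continuous_map (character_topology e) (character_topology e) (\<lambda>\<eta>. char_quotient e \<eta> \<psi>)"
    proof (rule continuous_map_into_character_topology)
      fix g assume "g \<in> carrier (pi1 e)"
      then show "continuous_map (character_topology e) euclidean (\<lambda>\<eta>. char_quotient e \<eta> \<psi> g)"
        using quot(1) by (simp add: char_quotient_def)
    qed (use \<psi> in \<open>simp add: topspace_character_topology char_quotient_in_characters\<close>)
    have cont2: "continuous_map (character_topology e) (character_topology e) (\<lambda>\<eta>. char_quotient e \<psi> \<eta>)"
    proof (rule continuous_map_into_character_topology)
      fix g assume "g \<in> carrier (pi1 e)"
      then show "continuous_map (character_topology e) euclidean (\<lambda>\<eta>. char_quotient e \<psi> \<eta> g)"
        using quot(2) by (simp add: char_quotient_def)
    qed (use \<psi> in \<open>simp add: topspace_character_topology char_quotient_in_characters\<close>)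
    define V where "V = {\<eta> \<in> topspace (character_topology e). char_quotient e \<eta> \<psi> \<in> W} \<inter>
        {\<eta> \<in> topspace (character_topology e). char_quotient e \<psi> \<eta> \<in> W}"
    have "openin (character_topology e) V"
      unfolding V_def by (intro openin_Int openin_continuous_map_preimage[OF _ W(1)] cont1 cont2)
    moreover have "char_quotient e \<psi> \<psi> = char_power e \<xi> 0"
      using nz[OF \<psi>] by (auto simp: char_quotient_def char_power_def restrict_def fun_eq_iff)
    then have "\<psi> \<in> V" using \<psi> W(2) by (simp add: V_def topspace_character_topology)
    moreover have "\<bar>q \<eta> - q \<psi>\<bar> \<le> \<epsilon>" if \<eta>: "\<eta> \<in> V" for \<eta>
    proof -
      have \<eta>c: "\<eta> \<in> characters e" using \<eta> by (simp add: V_def topspace_character_topology)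
      have b: "competitor_bound e x (char_quotient e \<eta> \<psi>) (1 + \<epsilon>)" "competitor_bound e x (char_quotient e \<psi> \<eta>) (1 + \<epsilon>)"
        using \<eta> W(3) by (auto simp: V_def)
      note r1 = widom_norm_ratio[OF \<eta>c \<psi> b(1)] and r2 = widom_norm_ratio[OF \<psi> \<eta>c b(2)]
      have "q \<eta> \<le> 1" "q \<psi> \<le> 1" using r1 r2 by (simp_all add: q_def inverse_le_1_iff)
      then have "\<epsilon> * q \<eta> \<le> \<epsilon>" "\<epsilon> * q \<psi> \<le> \<epsilon>" using \<epsilon> by (simp_all add: mult_left_le)
      moreover have "q \<psi> \<le> q \<eta> + \<epsilon> * q \<eta>" "q \<eta> \<le> q \<psi> + \<epsilon> * q \<psi>"
        using r1 r2 by (simp_all add: q_def algebra_simps)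
      ultimately show ?thesis by (simp add: abs_le_iff)
    qed
    ultimately show ?thesis by blast
  qed
  have "openin (character_topology e) {\<psi> \<in> topspace (character_topology e). q \<psi> \<in> U}" if "open U" for U
  proof (subst openin_subopen, intro ballI)
    fix \<psi> assume "\<psi> \<in> {\<psi> \<in> topspace (character_topology e). q \<psi> \<in> U}"
    then have \<psi>: "\<psi> \<in> characters e" "q \<psi> \<in> U" by (auto simp: topspace_character_topology)
    then obtain \<epsilon> where \<epsilon>: "0 < \<epsilon>" "cball (q \<psi>) \<epsilon> \<subseteq> U" using \<open>open U\<close> open_contains_cball by blast
    obtain V where V: "openin (character_topology e) V" "\<psi> \<in> V" "\<forall>\<eta>\<in>V. \<bar>q \<eta> - q \<psi>\<bar> \<le> \<epsilon>"
      using near[OF \<psi>(1) \<epsilon>(1)] by blast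
    have "V \<subseteq> {\<psi> \<in> topspace (character_topology e). q \<psi> \<in> U}"
      using V \<epsilon>(2) openin_subset[OF V(1)] by (force simp: dist_real_def)
    then show "\<exists>T. openin (character_topology e) T \<and> \<psi> \<in> T \<and>
        T \<subseteq> {\<psi> \<in> topspace (character_topology e). q \<psi> \<in> U}"
      using V by blast
  qed
  then show ?thesis unfolding q_def by (simp add: continuous_map)
qed

lemma widom_maximizer_0:
  assumes "\<psi> \<in> characters e"
  shows "widom_maximizer e x \<psi> 0 = of_real (inverse (widom_norm e x \<psi>))"
  using widom_norm_minimal(3)[OF competitor_bound_all[OF assms]]
  by (simp add: widom_maximizer_def widom_norm_def divide_inverse)

end

theorem theorem1p5:
  fixes e :: "complex set"
    and G :: "complex \<Rightarrow> real"
    and x :: "complex \<Rightarrow> riemann_sphere"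
    and B :: "complex \<Rightarrow> complex"
    and \<xi>\<^sub>e :: sphere_character
  assumes "compact e"
    and "log_capacity e > 0"
    and "connected (Omega e)"
    and "green_function e G"
    and "universal_covering e x"
    and "complex_green e G x B"
    and "is_character_of e x B \<xi>\<^sub>e"
    and "regular_set e G"
    and "canonical_generator e \<xi>\<^sub>e"
    and "PW_set e G"
    and "bounded (range (\<lambda>n. sup_norm (widom_minimizer e x (char_power e \<xi>\<^sub>e n))))"
    and "almost_periodic (\<lambda>n. sup_norm (widom_minimizer e x (char_power e \<xi>\<^sub>e n)))"
  shows "DCT_set e G x"
proof -
  obtain M where M: "\<And>n. \<bar>widom_norm e x (char_power e \<xi>\<^sub>e n)\<bar> \<le> M"
    using assms(11) unfolding bounded_iff widom_norm_def by auto
  interpret uniformized_domain e x by unfold_locales (rule assms(5))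
  interpret bounded_widom_powers e x \<xi>\<^sub>e M
  proof unfold_locales
    show "\<xi>\<^sub>e \<in> characters e" using assms(7) by (simp add: is_character_of_def)
    show "canonical_generator e \<xi>\<^sub>e" by (rule assms(9))
    show "\<exists>M. competitor_bound e x (char_power e \<xi>\<^sub>e (int n)) M" for n
      using assms(4,6,7,2) by (rule competitor_bound_nonneg_power)
    show "widom_norm e x (char_power e \<xi>\<^sub>e n) \<le> M" for n using M[of n] by (rule abs_le_D1)
  qed
  have "continuous_map (character_topology e) euclideanreal (\<lambda>\<psi>. inverse (widom_norm e x \<psi>))"
    using assms(12) unfolding widom_norm_def[symmetric] by (rule continuous_map_inverse_widom_norm)
  then have "continuous_map (character_topology e) euclidean
      (\<lambda>\<psi>. complex_of_real (inverse (widom_norm e x \<psi>)))"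
    unfolding continuous_map_atin limitin_canonical_iff by (intro ballI tendsto_of_real) blast
  then have "continuous_map (character_topology e) euclidean (\<lambda>\<psi>. widom_maximizer e x \<psi> 0)"
    by (rule continuous_map_eq) (simp add: topspace_character_topology widom_maximizer_0)
  then show ?thesis using assms(10) by (simp add: DCT_set_def)
qed

end
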